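(* Let a system $A$ of digit sets be given: a set $A_\emptyset=\{0,a\}$ with $a\in\mathbb{Z}$ odd and, inductively, for every $k\ge1$ and all $a_0\in A_\emptyset$, $a_1\in A_{a_0},\dots,a_{k-1}\in A_{a_0\dots a_{k-2}}$, a set $A_{a_0\dots a_{k-1}}=\{0,a(a_0,\dots,a_{k-1})\}$ with $a(a_0,\dots,a_{k-1})\in\mathbb{Z}$ odd. Let $$\Lambda:=\left\{\sum_{k=0}^n4^ka_k : a_0\in A_\emptyset,\ a_1\in A_{a_0},\dots,\ a_n\in A_{a_0\dots a_{n-1}},\ n\ge0\right\}.$$ (i) The exponentials $\{e_\lambda:\lambda\in\Lambda\}$ form an orthogonal family in $L^2(\mu_4)$. There exists a unique spectral labeling $\mathcal L$ of the infinite binary tree such that $\Lambda\subset\Lambda(\mathcal L)$. Moreover $\Lambda(\mathcal L)=\Lambda(A)$. (ii) If the sets $A_{a_0\dots a_k}$ are uniformly bounded, then $\Lambda(\mathcal L)$ is a spectrum for $\mu_4$.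
   Context: Measure. $\mu_4$ is the unique Borel probability measure on $\mathbb{R}$ satisfying $\int f(x)\,d\mu_4(x)=\frac12\left(\int f(\tfrac{x}{4})\,d\mu_4(x)+\int f(\tfrac{x+2}{4})\,d\mu_4(x)\right)$ for all $f\in C_c(\mathbb{R})$. For $\lambda\in\mathbb{R}$, $e_\lambda(x):=e^{2\pi i\lambda x}$. A set $\Lambda\subset\mathbb{R}$ is a spectrum for $\mu_4$ if $\{e_\lambda:\lambda\in\Lambda\}$ is an orthonormal basis of $L^2(\mu_4)$. Base 4 expansion. For $k\in\mathbb{Z}$ put $k_0=k$ and inductively $k_n=d_n+4k_{n+1}$ with $d_n\in\{0,1,2,3\}$, $k_{n+1}\in\mathbb{Z}$. The infinite string $d_0d_1d_2\dots$ is the base 4 expansion of $k$, written $k=d_0d_1\dots$. It ends in $\underline 0=000\dots$ if $k\ge0$ and in $\underline 3=333\dots$ if $k<0$. Conversely every infinite string over $\{0,1,2,3\}$ ending in $\underline 0$ or $\underline 3$ is the expansion of exactly one integer: $d_0\dots d_N\underline 0=\sum_{n=0}^N4^nd_n$ and $d_0\dots d_N\underline 3=\sum_{n=0}^N4^nd_n-4^{N+1}$. Spectral labeling. Let $\mathcal T$ be the complete infinite rooted binary tree (root $\emptyset$, each vertex having two outgoing edges to its two children). A spectral labeling $\mathcal L$ is a labeling of the edges of $\mathcal T$ with labels in $\{0,1,2,3\}$ such that: (i) for each vertex $v$, the two edges starting from $v$ have labels of different parity; (ii) for each vertex $v$ there exists an infinite (downward) path starting from $v$ whose edges are eventually all labeled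 $0$ or eventually all labeled $3$. Given a spectral labeling, each vertex is identified with the finite word of labels read along the unique path from $\emptyset$ to it, and an infinite path with the infinite word of labels read along it; accordingly, two spectral labelings with the same set of vertex words (i.e. differing by an automorphism of the rooted tree) are regarded as the same. Put $$\Lambda(\mathcal L):=\{k=d_0d_1\dots\in\mathbb{Z} : d_0d_1\dots\text{ is an infinite path in the tree starting from }\emptyset\text{ and ending in }\underline 0\text{ or }\underline 3\}.$$ Modified expansions. An integer $\lambda$ has a modified base 4 expansion with digits in $A$ if there is an infinite sequence $a_0a_1\dots$ with $a_0\in A_\emptyset$, $a_k\in A_{a_0\dots a_{k-1}}$ for all $k\ge1$, and $\sum_{k=0}^{n-1}a_k4^k\equiv\lambda \pmod{4^n}$ for all $n\ge0$. $\Lambda(A)$ denotes the set of all integers having a modified base 4 expansion with digits in $A$. Uniformly bounded means there is a constant $C$ with $|d|\le C$ for every element $d$ of every digit set in the system $A$. *)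

theory Defs
  imports "HOL-Probability.Probability" "HOL-Number_Theory.Cong"
begin

section \<open>The measure $\mu_4$ and its spectra\<close>

text \<open>The measure $\mu_4$ is the only Borel probability measure with this property
  (it is the normalised invariant measure of the maps $x/4$ and $(x+2)/4$),
  so a measure satisfying \<open>is_mu4\<close> is $\mu_4$.\<close>

definition is_mu4 :: "real measure \<Rightarrow> bool" where
  "is_mu4 M \<longleftrightarrow> prob_space M \<and> sets M = sets borel \<and>
     (\<forall>f :: real \<Rightarrow> complex.
        continuous_on UNIV f \<and> compact (closure {x. f x \<noteq> 0}) \<longrightarrow>
        (\<integral>x. f x \<partial>M) = ((\<integral>x. f (x / 4) \<partial>M) + (\<integral>x. f ((x + 2) / 4) \<partial>M)) / 2)"

definition expo :: "real \<Rightarrow> real \<Rightarrow> complex" where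
  "expo l x = exp (2 * complex_of_real pi * \<i> * complex_of_real l * complex_of_real x)"

text \<open>Elements of $L^2(M)$ are represented by square integrable functions; everything below is
  invariant under changes on null sets.\<close>

definition L2 :: "'a measure \<Rightarrow> ('a \<Rightarrow> complex) set" where
  "L2 M = {f \<in> borel_measurable M. integrable M (\<lambda>x. (cmod (f x))\<^sup>2)}"

definition L2_inner :: "'a measure \<Rightarrow> ('a \<Rightarrow> complex) \<Rightarrow> ('a \<Rightarrow> complex) \<Rightarrow> complex" where
  "L2_inner M f g = (\<integral>x. f x * cnj (g x) \<partial>M)"

definition L2_norm :: "'a measure \<Rightarrow> ('a \<Rightarrow> complex) \<Rightarrow> real" where
  "L2_norm M f = sqrt (\<integral>x. (cmod (f x))\<^sup>2 \<partial>M)"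

definition orthogonal_family :: "'a measure \<Rightarrow> ('i \<Rightarrow> 'a \<Rightarrow> complex) \<Rightarrow> 'i set \<Rightarrow> bool" where
  "orthogonal_family M b I \<longleftrightarrow>
     (\<forall>i\<in>I. b i \<in> L2 M) \<and> (\<forall>i\<in>I. \<forall>j\<in>I. i \<noteq> j \<longrightarrow> L2_inner M (b i) (b j) = 0)"

text \<open>An orthonormal basis of a Hilbert space: an orthonormal family with dense linear span.\<close>

definition orthonormal_basis :: "'a measure \<Rightarrow> ('i \<Rightarrow> 'a \<Rightarrow> complex) \<Rightarrow> 'i set \<Rightarrow> bool" where
  "orthonormal_basis M b I \<longleftrightarrow>
     orthogonal_family M b I \<and> (\<forall>i\<in>I. L2_norm M (b i) = 1) \<and>
     (\<forall>f\<in>L2 M. \<forall>\<epsilon>>0. \<exists>F c. finite F \<and> F \<subseteq> I \<and>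
        L2_norm M (\<lambda>x. f x - (\<Sum>i\<in>F. c i * b i x)) < \<epsilon>)"

definition is_spectrum :: "real measure \<Rightarrow> real set \<Rightarrow> bool" where
  "is_spectrum M \<Lambda> \<longleftrightarrow> orthonormal_basis M expo \<Lambda>"

section \<open>Base 4 expansions of integers\<close>

text \<open>Since \<open>div\<close> rounds towards $-\infty$ and \<open>mod 4\<close> takes values in $\{0,1,2,3\}$,
  these are the $k_n$ and $d_n$ determined by $k_0 = k$ and $k_n = d_n + 4 k_{n+1}$.\<close>

primrec base4_rest :: "int \<Rightarrow> nat \<Rightarrow> int" where
  "base4_rest k 0 = k"
| "base4_rest k (Suc n) = base4_rest k n div 4"

definition base4_digit :: "int \<Rightarrow> nat \<Rightarrow> int" where
  "base4_digit k n = base4_rest k n mod 4"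

definition eventually_constant :: "(nat \<Rightarrow> int) \<Rightarrow> int \<Rightarrow> bool" where
  "eventually_constant w d \<longleftrightarrow> (\<exists>N. \<forall>n\<ge>N. w n = d)"

section \<open>Spectral labelings\<close>

text \<open>The vertices of the complete infinite binary tree are the finite lists of booleans, the root
  being \<open>[]\<close> and the children of \<open>v\<close> being \<open>v @ [False]\<close> and \<open>v @ [True]\<close>. A labeling \<open>L\<close> assigns to
  the edge from \<open>v\<close> to \<open>v @ [b]\<close> the label \<open>L v b\<close>. A downward path from \<open>v\<close> is the sequence
  \<open>p\<close> of its branching choices.\<close>

type_synonym labeling = "bool list \<Rightarrow> bool \<Rightarrow> int"

definition path_word :: "labeling \<Rightarrow> bool list \<Rightarrow> (nat \<Rightarrow> bool) \<Rightarrow> nat \<Rightarrow> int" where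
  "path_word L v p n = L (v @ map p [0..<n]) (p n)"

definition spectral_labeling :: "labeling \<Rightarrow> bool" where
  "spectral_labeling L \<longleftrightarrow>
     (\<forall>v b. L v b \<in> {0, 1, 2, 3}) \<and>
     (\<forall>v. even (L v False) \<noteq> even (L v True)) \<and>
     (\<forall>v. \<exists>p. eventually_constant (path_word L v p) 0 \<or>
               eventually_constant (path_word L v p) 3)"

definition vertex_word :: "labeling \<Rightarrow> bool list \<Rightarrow> int list" where
  "vertex_word L v = map (\<lambda>n. L (take n v) (v ! n)) [0..<length v]"

text \<open>Labelings with the same set of vertex words are identified.\<close>

definition same_labeling :: "labeling \<Rightarrow> labeling \<Rightarrow> bool" where
  "same_labeling L L' \<longleftrightarrow> range (vertex_word L) = range (vertex_word L')"

definition Lambda_labeling :: "labeling \<Rightarrow> int set" where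
  "Lambda_labeling L = {k. \<exists>p. path_word L [] p = base4_digit k \<and>
     (eventually_constant (path_word L [] p) 0 \<or> eventually_constant (path_word L [] p) 3)}"

section \<open>Systems of digit sets\<close>

text \<open>The digit set \<open>A w\<close> is only meaningful for words \<open>w\<close> in \<open>digit_words A\<close>, i.e. for
  $w = a_0 \dots a_{k-1}$ with $a_i \in A_{a_0 \dots a_{i-1}}$ for all $i < k$.\<close>

definition digit_words :: "(int list \<Rightarrow> int set) \<Rightarrow> int list set" where
  "digit_words A = {w. \<forall>i<length w. w ! i \<in> A (take i w)}"

definition digit_system :: "(int list \<Rightarrow> int set) \<Rightarrow> bool" where
  "digit_system A \<longleftrightarrow> (\<forall>w\<in>digit_words A. \<exists>a. odd a \<and> A w = {0, a})"

definition digit_sums :: "(int list \<Rightarrow> int set) \<Rightarrow> int set" where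
  "digit_sums A = {\<Sum>k\<le>n. 4 ^ k * w ! k | n w. w \<in> digit_words A \<and> length w = Suc n}"

definition modified_expansion :: "(int list \<Rightarrow> int set) \<Rightarrow> (nat \<Rightarrow> int) \<Rightarrow> int \<Rightarrow> bool" where
  "modified_expansion A s l \<longleftrightarrow>
     (\<forall>k. s k \<in> A (map s [0..<k])) \<and> (\<forall>n. [(\<Sum>k<n. s k * 4 ^ k) = l] (mod 4 ^ n))"

definition Lambda_digits :: "(int list \<Rightarrow> int set) \<Rightarrow> int set" where
  "Lambda_digits A = {l. \<exists>s. modified_expansion A s l}"

definition uniformly_bounded :: "(int list \<Rightarrow> int set) \<Rightarrow> bool" where
  "uniformly_bounded A \<longleftrightarrow> (\<exists>C. \<forall>w\<in>digit_words A. \<forall>d\<in>A w. \<bar>d\<bar> \<le> C)"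

end

theory Submission
  imports Defs
begin

text \<open>Write $\hat\mu$ for the Fourier transform of $\mu_4$. It satisfies
  $|\hat\mu(t)|^2 = \cos^2(\pi t/2)\,|\hat\mu(t/4)|^2$, so it vanishes at $4^k q$ for odd $q$, and two
  different modified expansions produce integers whose difference has this form. The labeling is
  obtained by reading off the base 4 digits of the partial sums; it is unique because the vertex
  words of any other candidate include these, while every labeling has $2^n$ vertex words of length $n$.

  For completeness it suffices that the sum of $|\hat\mu(t-\lambda)|^2$ over $\Lambda$ is 1 for all
  real $t$. The factors $\cos^2$ define the transition probabilities of a random walk
  $x \mapsto (x-d)/4$ along the digit tree, started at $t$, and $|\hat\mu(t-\lambda)|^2$ is the probability
  of following the expansion of $\lambda$ forever. Since the digits are bounded, the walk stays in a
  compact interval, and from each of its points some element of $\Lambda$ is followed forever with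
  probability at least a fixed positive constant. Hence no mass escapes.\<close>

section \<open>Words of digits and modified expansions\<close>

text \<open>The combinatorics is done with residues modulo \<open>4 ^ n\<close>. Words of one length
  with congruent sums are equal, so membership in \<open>Lambda_digits A\<close> can be tested
  length by length; base 4 labels and walk probabilities also depend on residues only.

  The set needed for completeness is \<open>Lambda_digits A\<close>, which besides the finite sums
  contains integers whose modified expansion never settles to zeros.

  The obstacle in the lower bound is that the Fourier transform has zeros among the nonzero
  integers. Near such a point, continuing with zeros has arbitrarily small probability, and one must
  aim at the nearby integer itself, which may have no modified expansion. The remedy is that every
  digit set contains both parities: when no digit matches modulo 4, one still matches modulo 2. The
  mismatch is then 2 modulo 4, and one division by 4 turns it into an odd multiple of 1/2, far from
  all integers, where continuing with zeros is safe.\<close>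

definition word_sum :: "int list \<Rightarrow> int" where
  "word_sum w = (\<Sum>k<length w. w ! k * 4 ^ k)"

definition words_of_length :: "(int list \<Rightarrow> int set) \<Rightarrow> nat \<Rightarrow> int list set" where
  "words_of_length A n = {w \<in> digit_words A. length w = n}"

lemma word_sum_Nil [simp]: "word_sum [] = 0"
  by (simp add: word_sum_def)

lemma word_sum_snoc [simp]: "word_sum (w @ [d]) = word_sum w + d * 4 ^ length w"
  by (simp add: word_sum_def nth_append)

lemma Nil_in_digit_words [simp]: "[] \<in> digit_words A"
  by (simp add: digit_words_def)

lemma snoc_in_digit_words_iff [simp]:
  "w @ [d] \<in> digit_words A \<longleftrightarrow> w \<in> digit_words A \<and> d \<in> A w"
  by (auto simp: digit_words_def nth_append less_Suc_eq)

lemma take_in_digit_words: "w \<in> digit_words A \<Longrightarrow> take n w \<in> digit_words A"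
  by (auto simp: digit_words_def min_def)

lemma word_sum_take_cong:
  assumes "n \<le> length w"
  shows "[word_sum (take n w) = word_sum w] (mod 4 ^ n)"
proof -
  have "word_sum w = word_sum (take n w) + (\<Sum>k\<in>{n..<length w}. w ! k * 4 ^ k)"
    unfolding word_sum_def lessThan_atLeast0
    using assms by (subst sum.atLeastLessThan_concat[symmetric, of 0 n]) (auto simp: min_def)
  moreover have "4 ^ n dvd (\<Sum>k\<in>{n..<length w}. w ! k * 4 ^ k)"
    by (intro dvd_sum dvd_mult) (auto intro: le_imp_power_dvd)
  ultimately show ?thesis by (simp add: cong_iff_dvd_diff dvd_diff_commute)
qed

lemma cong_power_le:
  fixes a b :: int
  assumes "[a = b] (mod 4 ^ n)" "m \<le> n"
  shows "[a = b] (mod 4 ^ m)"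
  using assms by (meson cong_dvd_modulus le_imp_power_dvd)

lemma digit_systemD:
  assumes "digit_system A" "w \<in> digit_words A"
  obtains a where "odd a" "A w = {0, a}"
  using assms unfolding digit_system_def by blast

lemma odd_diff_digits:
  assumes "digit_system A" "w \<in> digit_words A" "d \<in> A w" "e \<in> A w" "d \<noteq> e"
  shows "odd (d - e)"
  using assms by (auto elim!: digit_systemD)

text \<open>By induction the prefixes agree. The last digits then agree modulo 4, in particular
  modulo 2, while the two elements of a digit set have different parity.\<close>

lemma digit_word_unique:
  assumes A: "digit_system A" and "u \<in> words_of_length A n" "v \<in> words_of_length A n"
    and "[word_sum u = word_sum v] (mod 4 ^ n)"
  shows "u = v"
  using assms(2-)
proof (induction n arbitrary: u v)
  case 0
  then show ?case by (simp add: words_of_length_def)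
next
  case (Suc n)
  obtain u' d where u: "u = u' @ [d]" "length u' = n" "u' \<in> digit_words A" "d \<in> A u'"
    using Suc.prems by (cases u rule: rev_cases) (auto simp: words_of_length_def)
  obtain v' e where v: "v = v' @ [e]" "length v' = n" "v' \<in> digit_words A" "e \<in> A v'"
    using Suc.prems by (cases v rule: rev_cases) (auto simp: words_of_length_def)
  have uv: "[word_sum u' + d * 4 ^ n = word_sum v' + e * 4 ^ n] (mod 4 ^ Suc n)"
    using Suc.prems u v by simp
  have "[word_sum u' = word_sum v'] (mod 4 ^ n)"
    using cong_power_le[OF uv, of n] by (simp add: cong_def)
  then have eq: "u' = v'"
    using Suc.IH[of u' v'] u v by (simp add: words_of_length_def)
  have "4 ^ Suc n dvd (d - e) * 4 ^ n"
    using uv by (simp add: eq cong_iff_dvd_diff algebra_simps)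
  then have "even (d - e)" by (auto simp: dvd_def)
  then have "d = e" using odd_diff_digits[OF A u(3,4), of e] v eq by blast
  then show ?case using u v eq by simp
qed

text \<open>Words chosen separately for each length are automatically prefixes of one another, by
  uniqueness, and so assemble into one infinite sequence.\<close>

lemma Lambda_digits_iff:
  assumes A: "digit_system A"
  shows "l \<in> Lambda_digits A \<longleftrightarrow>
    (\<forall>n. \<exists>w\<in>words_of_length A n. [word_sum w = l] (mod 4 ^ n))"
proof
  assume "l \<in> Lambda_digits A"
  then obtain s where s: "s k \<in> A (map s [0..<k])" "[(\<Sum>k<n. s k * 4 ^ k) = l] (mod 4 ^ n)" for k n
    by (auto simp: Lambda_digits_def modified_expansion_def)
  have "map s [0..<n] \<in> words_of_length A n" for n
    using s(1) by (auto simp: words_of_length_def digit_words_def take_map)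
  moreover have "[word_sum (map s [0..<n]) = l] (mod 4 ^ n)" for n
    using s(2)[of n] by (simp add: word_sum_def)
  ultimately show "\<forall>n. \<exists>w\<in>words_of_length A n. [word_sum w = l] (mod 4 ^ n)" by blast
next
  assume "\<forall>n. \<exists>w\<in>words_of_length A n. [word_sum w = l] (mod 4 ^ n)"
  then obtain u where u: "u n \<in> words_of_length A n" "[word_sum (u n) = l] (mod 4 ^ n)" for n
    by metis
  have len: "length (u n) = n" and uA: "u n \<in> digit_words A" for n
    using u(1)[of n] by (auto simp: words_of_length_def)
  have take_u: "take n (u (Suc n)) = u n" for n
  proof (rule digit_word_unique[OF A])
    show "take n (u (Suc n)) \<in> words_of_length A n"
      using uA[of "Suc n"] len[of "Suc n"] by (auto simp: words_of_length_def take_in_digit_words)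
    have "[word_sum (take n (u (Suc n))) = word_sum (u (Suc n))] (mod 4 ^ n)"
      by (rule word_sum_take_cong) (simp add: len)
    also have "[word_sum (u (Suc n)) = l] (mod 4 ^ n)"
      by (rule cong_power_le[OF u(2)]) simp
    also have "[l = word_sum (u n)] (mod 4 ^ n)"
      using u(2) by (rule cong_sym)
    finally show "[word_sum (take n (u (Suc n))) = word_sum (u n)] (mod 4 ^ n)" .
  qed (rule u)
  define s where "s k = u (Suc k) ! k" for k
  have map_s: "map s [0..<n] = u n" for n
  proof (induction n)
    case (Suc n)
    have "u (Suc n) = take n (u (Suc n)) @ [u (Suc n) ! n]"
      using len[of "Suc n"] take_Suc_conv_app_nth[of n "u (Suc n)"] by simp
    with Suc show ?case by (simp add: take_u s_def)
  qed (use len[of 0] in simp)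
  have "modified_expansion A s l"
    unfolding modified_expansion_def
  proof (intro conjI allI)
    show "s k \<in> A (map s [0..<k])" for k
    proof -
      have "map s [0..<Suc k] \<in> digit_words A" using uA map_s by metis
      then show ?thesis by simp
    qed
    show "[(\<Sum>k<n. s k * 4 ^ k) = l] (mod 4 ^ n)" for n
      using u(2)[of n] by (simp add: map_s[symmetric] word_sum_def)
  qed
  then show "l \<in> Lambda_digits A" by (auto simp: Lambda_digits_def)
qed

lemma zeros_in_digit_words:
  assumes "digit_system A" "w \<in> digit_words A"
  shows "w @ replicate n 0 \<in> digit_words A \<and> word_sum (w @ replicate n 0) = word_sum w"
proof (induction n)
  case (Suc n)
  have "w @ replicate (Suc n) 0 = (w @ replicate n 0) @ [0]"
    by (simp add: replicate_append_same)
  then show ?case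
    using Suc assms(1) by (auto elim!: digit_systemD simp del: append_assoc)
qed (use assms in simp)

text \<open>Every digit set contains 0, so a word can be padded with zeros without changing its
  sum.\<close>

lemma word_sum_in_Lambda_digits:
  assumes A: "digit_system A" and w: "w \<in> digit_words A"
  shows "word_sum w \<in> Lambda_digits A"
  unfolding Lambda_digits_iff[OF A]
proof (intro allI bexI)
  fix n
  define v where "v = w @ replicate n 0"
  have v: "v \<in> digit_words A" "word_sum v = word_sum w" "n \<le> length v"
    using zeros_in_digit_words[OF assms] by (auto simp: v_def)
  show "take n v \<in> words_of_length A n"
    using v by (simp add: words_of_length_def take_in_digit_words)
  show "[word_sum (take n v) = word_sum w] (mod 4 ^ n)"
    using word_sum_take_cong[OF v(3)] v(2) by simp
qed

lemma digit_sums_eq: "digit_sums A = {word_sum w | w. w \<in> digit_words A \<and> w \<noteq> []}"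
proof -
  have *: "word_sum w = (\<Sum>k\<le>n. 4 ^ k * w ! k)" if "length w = Suc n" for w n
    unfolding word_sum_def that lessThan_Suc_atMost by (simp add: mult.commute)
  have "x \<in> digit_sums A \<longleftrightarrow> (\<exists>n w. x = word_sum w \<and> w \<in> digit_words A \<and> length w = Suc n)" for x
    unfolding digit_sums_def mem_Collect_eq by (intro ex_cong1) (metis *)
  moreover have "w \<noteq> [] \<longleftrightarrow> (\<exists>n. length w = Suc n)" for w :: "int list"
    by (cases w) auto
  ultimately have "x \<in> digit_sums A \<longleftrightarrow> (\<exists>w. x = word_sum w \<and> w \<in> digit_words A \<and> w \<noteq> [])" for x
    by metis
  then show ?thesis by auto
qed

lemma digit_sums_subset:
  assumes "digit_system A"
  shows "digit_sums A \<subseteq> Lambda_digits A"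
  using word_sum_in_Lambda_digits[OF assms] by (auto simp: digit_sums_eq)

lemma exists_power4_gt: "\<exists>n. \<bar>x\<bar> < (4::int) ^ n"
proof
  have "x' < 4 ^ x'" for x' :: nat by (induction x') auto
  from this[of "nat \<bar>x\<bar>"] show "\<bar>x\<bar> < 4 ^ nat \<bar>x\<bar>"
    by (metis abs_ge_zero int_nat_eq of_nat_less_iff of_nat_numeral of_nat_power)
qed

text \<open>The two expansions first differ at the digit with index \<open>k\<close>, where one has 0 and the other
  an odd number.\<close>

lemma Lambda_digits_diff:
  assumes A: "digit_system A" and l: "l \<in> Lambda_digits A" "l' \<in> Lambda_digits A" "l \<noteq> l'"
  obtains k q where "odd q" "l - l' = 4 ^ k * q"
proof -
  obtain N where "\<bar>l - l'\<bar> < 4 ^ N" using exists_power4_gt by blast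
  then have "\<not> [l = l'] (mod 4 ^ N)"
    using l(3) dvd_imp_le_int[of "l - l'" "4 ^ N"] by (auto simp: cong_iff_dvd_diff)
  then obtain n where n: "\<not> [l = l'] (mod 4 ^ n)" "\<forall>m<n. [l = l'] (mod 4 ^ m)"
    using exists_least_iff[of "\<lambda>n. \<not> [l = l'] (mod 4 ^ n)"] by blast
  then obtain k where k: "n = Suc k" by (cases n) auto
  have lk: "[l = l'] (mod 4 ^ k)" using n k by simp
  obtain u where u: "u \<in> words_of_length A n" "[word_sum u = l] (mod 4 ^ n)"
    using l Lambda_digits_iff[OF A] by metis
  obtain v where v: "v \<in> words_of_length A n" "[word_sum v = l'] (mod 4 ^ n)"
    using l Lambda_digits_iff[OF A] by metis
  obtain u' d where u': "u = u' @ [d]" "length u' = k" "u' \<in> digit_words A" "d \<in> A u'"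
    using u k by (cases u rule: rev_cases) (auto simp: words_of_length_def)
  obtain v' e where v': "v = v' @ [e]" "length v' = k" "v' \<in> digit_words A" "e \<in> A v'"
    using v k by (cases v rule: rev_cases) (auto simp: words_of_length_def)
  have "[word_sum u' = word_sum u] (mod 4 ^ k)" "[word_sum v' = word_sum v] (mod 4 ^ k)"
    using u' v' by (auto simp: cong_def)
  moreover have "[word_sum u = l] (mod 4 ^ k)" "[word_sum v = l'] (mod 4 ^ k)"
    using cong_power_le[OF u(2), of k] cong_power_le[OF v(2), of k] k by auto
  ultimately have "[word_sum u' = word_sum v'] (mod 4 ^ k)"
    using lk by (meson cong_sym cong_trans)
  then have eq: "u' = v'"
    using digit_word_unique[OF A] u' v' by (simp add: words_of_length_def)
  have "d \<noteq> e"
    using n(1) u(2) v(2) u' v' eq by (metis cong_sym cong_trans)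
  then have odd: "odd (d - e)" using odd_diff_digits[OF A] u' v' eq by blast
  have "[word_sum u - word_sum v = l - l'] (mod 4 ^ n)"
    using u(2) v(2) by (rule cong_diff)
  then have "4 ^ Suc k dvd l - l' - (d - e) * 4 ^ k"
    using u' v' eq k by (simp add: cong_iff_dvd_diff dvd_diff_commute algebra_simps)
  then obtain z where "l - l' = 4 ^ k * (d - e + 4 * z)"
    by (auto simp: dvd_def algebra_simps)
  moreover have "odd (d - e + 4 * z)" using odd by simp
  ultimately show ?thesis using that by blast
qed

section \<open>The spectral labeling of a digit system\<close>

lemma base4_rest_eq: "base4_rest k n = k div 4 ^ n"
  by (induction n) (simp_all add: zdiv_zmult2_eq power_Suc2 del: power_Suc)

lemma mod_power4_Suc: "k mod 4 ^ Suc n = 4 ^ n * base4_digit k n + k mod 4 ^ n"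
  using zmod_zmult2_eq[of 4 k "4 ^ n"]
  by (simp add: base4_digit_def base4_rest_eq mult.commute)

text \<open>The dictionary between labels of the tree and congruences of partial sums.\<close>

lemma base4_digits_eq_iff:
  "(\<forall>i<n. base4_digit k i = base4_digit l i) \<longleftrightarrow> [k = l] (mod 4 ^ n)"
proof (induction n)
  case (Suc n)
  have "[k = l] (mod 4 ^ Suc n) \<longleftrightarrow> [k = l] (mod 4 ^ n) \<and> base4_digit k n = base4_digit l n"
    using cong_power_le[of k l "Suc n" n] by (auto simp: cong_def mod_power4_Suc simp del: power_Suc)
  with Suc show ?case by (auto simp: less_Suc_eq)
qed simp

lemma eventually_constant_base4_digit:
  "eventually_constant (base4_digit k) 0 \<or> eventually_constant (base4_digit k) 3"
proof -
  obtain N where N: "\<bar>k\<bar> < 4 ^ N" using exists_power4_gt by blast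
  have less: "\<bar>k\<bar> < 4 ^ n" if "n \<ge> N" for n
  proof -
    have "(4::int) ^ N \<le> 4 ^ n" using that by simp
    with N show ?thesis by linarith
  qed
  show ?thesis
  proof (cases "k \<ge> 0")
    case True
    then have "base4_digit k n = 0" if "n \<ge> N" for n
      using less[OF that] by (simp add: base4_digit_def base4_rest_eq)
    then show ?thesis by (auto simp: eventually_constant_def)
  next
    case False
    have "base4_digit k n = 3" if "n \<ge> N" for n
    proof -
      \<comment> \<open>The witness \<open>k + 4 ^ n\<close> is the remainder in k = -1 * 4 ^ n + (k
        + 4 ^ n); the digit is 3 because -1 mod 4 = 3.\<close>
      have "k div 4 ^ n = -1"
        using less[OF that] False by (intro int_div_pos_eq[of _ _ _ "k + 4 ^ n"]) auto
      then show ?thesis by (simp add: base4_digit_def base4_rest_eq)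
    qed
    then show ?thesis by (auto simp: eventually_constant_def)
  qed
qed

definition odd_digit :: "(int list \<Rightarrow> int set) \<Rightarrow> int list \<Rightarrow> int" where
  "odd_digit A w = (THE a. odd a \<and> a \<in> A w)"

text \<open>Identifies vertices with digit words: \<open>True\<close> selects the odd digit and
  \<open>False\<close> the digit 0. The word is built from the left because each digit set depends
  on the digits already chosen.\<close>

definition digit_word :: "(int list \<Rightarrow> int set) \<Rightarrow> bool list \<Rightarrow> int list" where
  "digit_word A v = fold (\<lambda>b w. w @ [if b then odd_digit A w else 0]) v []"

text \<open>The label cannot be computed from the new digit alone, since carries from all earlier
  digits enter; hence the sum up to the lower end of the edge.\<close>

definition digit_labeling :: "(int list \<Rightarrow> int set) \<Rightarrow> labeling" where
  "digit_labeling A v b = base4_digit (word_sum (digit_word A (v @ [b]))) (length v)"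

lemma odd_digit:
  assumes "digit_system A" "w \<in> digit_words A"
  shows "odd (odd_digit A w)" "A w = {0, odd_digit A w}"
proof -
  obtain a where a: "odd a" "A w = {0, a}" using assms by (rule digit_systemD)
  then have "odd_digit A w = a" by (auto simp: odd_digit_def intro!: the_equality)
  with a show "odd (odd_digit A w)" "A w = {0, odd_digit A w}" by auto
qed

lemma digit_word_Nil [simp]: "digit_word A [] = []"
  by (simp add: digit_word_def)

lemma digit_word_snoc [simp]:
  "digit_word A (v @ [b]) =
    digit_word A v @ [if b then odd_digit A (digit_word A v) else 0]"
  by (simp add: digit_word_def)

lemma length_digit_word [simp]: "length (digit_word A v) = length v"
  by (induction v rule: rev_induct) auto

lemma take_digit_word: "take n (digit_word A v) = digit_word A (take n v)"
  by (induction v rule: rev_induct) (auto simp: take_Cons')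

lemma digit_word_in_digit_words:
  assumes "digit_system A"
  shows "digit_word A v \<in> digit_words A"
  by (induction v rule: rev_induct) (auto simp: odd_digit(2)[OF assms])

lemma digit_word_surj:
  assumes A: "digit_system A" and "w \<in> digit_words A"
  obtains v where "digit_word A v = w"
proof -
  have "\<exists>v. digit_word A v = w"
    using assms(2)
  proof (induction w rule: rev_induct)
    case (snoc d w)
    then obtain v where v: "digit_word A v = w" and d: "d \<in> {0, odd_digit A w}"
      using odd_digit(2)[OF A, of w] by auto
    then have "digit_word A (v @ [d \<noteq> 0]) = w @ [d]" by auto
    then show ?case by blast
  qed (auto intro: exI[of _ "[]"])
  then show ?thesis using that by blast
qed

text \<open>Digits after index i contribute multiples of \<open>4 ^ Suc i\<close>, so all labels on
  the way to v can be read from the single sum at v.\<close>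

lemma digit_labeling_eq:
  assumes "i < length v"
  shows "digit_labeling A (take i v) (v ! i) = base4_digit (word_sum (digit_word A v)) i"
proof -
  have "[word_sum (take (Suc i) (digit_word A v)) = word_sum (digit_word A v)] (mod 4 ^ Suc i)"
    using assms by (intro word_sum_take_cong) simp
  then have "base4_digit (word_sum (digit_word A (take (Suc i) v))) i
      = base4_digit (word_sum (digit_word A v)) i"
    unfolding base4_digits_eq_iff[symmetric] take_digit_word by simp
  then show ?thesis
    using assms by (simp add: digit_labeling_def take_Suc_conv_app_nth del: digit_word_snoc)
qed

lemma vertex_word_digit_labeling:
  "vertex_word (digit_labeling A) v = map (base4_digit (word_sum (digit_word A v))) [0..<length v]"
  by (simp add: vertex_word_def digit_labeling_eq)

lemma path_word_digit_labeling:
  assumes "i < n"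
  shows "path_word (digit_labeling A) [] p i =
    base4_digit (word_sum (digit_word A (map p [0..<n]))) i"
  using digit_labeling_eq[of i "map p [0..<n]" A] assms
  by (simp add: path_word_def take_map)

text \<open>A path spells l exactly when its partial sums converge to l in the 4-adic sense.\<close>

lemma path_word_digit_labeling_eq_iff:
  "path_word (digit_labeling A) [] p = base4_digit l \<longleftrightarrow>
    (\<forall>n. [word_sum (digit_word A (map p [0..<n])) = l] (mod 4 ^ n))"
proof -
  have "[word_sum (digit_word A (map p [0..<n])) = l] (mod 4 ^ n) \<longleftrightarrow>
      (\<forall>i<n. path_word (digit_labeling A) [] p i = base4_digit l i)" for n
    by (simp add: path_word_digit_labeling flip: base4_digits_eq_iff)
  then show ?thesis by (auto simp: fun_eq_iff)
qed

text \<open>At a vertex of depth n with sum s, the label for the digit d has the parity of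
  \<open>s div 4 ^ n + d\<close>, and d is 0 or odd. Choosing 0 forever keeps the sum at s, so this
  path reads the tail of the expansion of the integer s.\<close>

lemma spectral_labeling_digit_labeling:
  assumes A: "digit_system A"
  shows "spectral_labeling (digit_labeling A)"
  unfolding spectral_labeling_def
proof (intro conjI allI)
  fix v b
  have "x mod 4 = 0 \<or> x mod 4 = 1 \<or> x mod 4 = 2 \<or> x mod 4 = 3" for x :: int by presburger
  then show "digit_labeling A v b \<in> {0, 1, 2, 3}"
    by (simp only: digit_labeling_def base4_digit_def insert_iff) blast
next
  fix v
  have digit: "even (base4_digit (s + d * 4 ^ n) n) \<longleftrightarrow> even (s div 4 ^ n + d)" for s d n
  proof -
    have "even (x mod 4) \<longleftrightarrow> even x" for x :: int by presburger
    then show ?thesis by (simp add: base4_digit_def base4_rest_eq add.commute)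
  qed
  let ?w = "digit_word A v"
  show "even (digit_labeling A v False) \<noteq> even (digit_labeling A v True)"
    using odd_digit(1)[OF A digit_word_in_digit_words[OF A], of v]
      digit[of "word_sum ?w" 0 "length v"] digit[of "word_sum ?w" "odd_digit A ?w" "length v"]
    by (simp add: digit_labeling_def)
next
  fix v
  define s where "s = word_sum (digit_word A v)"
  have "word_sum (digit_word A (v @ replicate n False)) = s" for n
  proof (induction n)
    case (Suc n)
    have "v @ replicate (Suc n) False = (v @ replicate n False) @ [False]"
      by (simp add: replicate_append_same)
    then show ?case using Suc by (simp del: append_assoc)
  qed (simp add: s_def)
  then have path: "path_word (digit_labeling A) v (\<lambda>_. False) n = base4_digit s (length v + n)" for n
    by (simp add: path_word_def digit_labeling_def map_replicate_const del: append_assoc)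
  have shift: "eventually_constant (path_word (digit_labeling A) v (\<lambda>_. False)) d"
    if "eventually_constant (base4_digit s) d" for d
    using that unfolding eventually_constant_def path by (meson trans_le_add2)
  show "\<exists>p. eventually_constant (path_word (digit_labeling A) v p) 0 \<or>
      eventually_constant (path_word (digit_labeling A) v p) 3"
    using eventually_constant_base4_digit[of s] shift by blast
qed

text \<open>The condition on the ends of paths is automatic here, because a path that spells an
  integer ends in 0s or 3s.\<close>

lemma Lambda_digit_labeling:
  assumes A: "digit_system A"
  shows "Lambda_labeling (digit_labeling A) = Lambda_digits A"
proof (intro equalityI subsetI)
  fix l assume "l \<in> Lambda_labeling (digit_labeling A)"
  then obtain p where "path_word (digit_labeling A) [] p = base4_digit l"
    by (auto simp: Lambda_labeling_def)
  then have p: "[word_sum (digit_word A (map p [0..<n])) = l] (mod 4 ^ n)" for n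
    by (simp add: path_word_digit_labeling_eq_iff)
  have "digit_word A (map p [0..<n]) \<in> words_of_length A n" for n
    using digit_word_in_digit_words[OF A] by (simp add: words_of_length_def)
  then show "l \<in> Lambda_digits A" using p by (auto simp: Lambda_digits_iff[OF A])
next
  fix l assume "l \<in> Lambda_digits A"
  then obtain s where s: "s k \<in> A (map s [0..<k])" "[(\<Sum>k<n. s k * 4 ^ k) = l] (mod 4 ^ n)" for k n
    by (auto simp: Lambda_digits_def modified_expansion_def)
  define p where "p k = (s k \<noteq> 0)" for k
  have eq: "digit_word A (map p [0..<n]) = map s [0..<n]" for n
  proof (induction n)
    case (Suc n)
    have "map s [0..<n] \<in> digit_words A"
      using s(1) by (auto simp: digit_words_def take_map)
    then have "s n \<in> {0, odd_digit A (map s [0..<n])}"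
      using s(1)[of n] odd_digit(2)[OF A] by blast
    with Suc show ?case by (auto simp: p_def)
  qed simp
  have "path_word (digit_labeling A) [] p = base4_digit l"
    unfolding path_word_digit_labeling_eq_iff eq using s(2) by (simp add: word_sum_def)
  then show "l \<in> Lambda_labeling (digit_labeling A)"
    using eventually_constant_base4_digit[of l] by (force simp: Lambda_labeling_def)
qed

section \<open>Vertex words and uniqueness of the labeling\<close>

lemma length_vertex_word [simp]: "length (vertex_word L v) = length v"
  by (simp add: vertex_word_def)

lemma vertex_word_snoc: "vertex_word L (v @ [b]) = vertex_word L v @ [L v b]"
  by (simp add: vertex_word_def nth_append)

lemma inj_vertex_word:
  assumes "spectral_labeling L"
  shows "inj (vertex_word L)"
proof (rule injI)
  fix u v assume "vertex_word L u = vertex_word L v"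
  then show "u = v"
  proof (induction u arbitrary: v rule: rev_induct)
    case Nil
    from arg_cong[OF this, of length] show ?case by simp
  next
    case (snoc b u)
    from arg_cong[OF snoc.prems, of length] obtain v' c where v: "v = v' @ [c]"
      by (cases v rule: rev_cases) auto
    then have "vertex_word L u = vertex_word L v'" "L u b = L v' c"
      using snoc.prems by (auto simp: vertex_word_snoc)
    then have "u = v'" "L u b = L u c" using snoc.IH by auto
    moreover have "even (L u False) \<noteq> even (L u True)"
      using assms by (simp add: spectral_labeling_def)
    ultimately show ?case using v by (cases b; cases c) auto
  qed
qed

text \<open>Every labeling has exactly $2^n$ vertex words of length $n$.\<close>

lemma same_labelingI:
  assumes "spectral_labeling L" "spectral_labeling L'"
    and sub: "range (vertex_word L) \<subseteq> range (vertex_word L')"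
  shows "same_labeling L' L"
proof -
  have "vertex_word L ` {v. length v = n} = vertex_word L' ` {v. length v = n}" for n
  proof (rule card_subset_eq)
    have fin: "finite {v :: bool list. length v = n}"
      using finite_lists_length_eq[of "UNIV :: bool set" n] by simp
    then show "finite (vertex_word L' ` {v. length v = n})" by simp
    show "vertex_word L ` {v. length v = n} \<subseteq> vertex_word L' ` {v. length v = n}"
    proof safe
      fix v :: "bool list"
      obtain u where u: "vertex_word L v = vertex_word L' u" using sub by blast
      then have "length u = length v" by (metis length_vertex_word)
      with u show "vertex_word L v \<in> vertex_word L' ` {u. length u = length v}" by auto
    qed
    show "card (vertex_word L ` {v. length v = n}) = card (vertex_word L' ` {v. length v = n})"
      using assms(1,2)[THEN inj_vertex_word] by (simp add: card_image inj_on_subset)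
  qed
  then have "range (vertex_word L') \<subseteq> range (vertex_word L)" by blast
  with sub show ?thesis by (auto simp: same_labeling_def)
qed

text \<open>A vertex word of \<open>digit_labeling A\<close> is an initial piece of the expansion of
  a finite digit sum, and L has a path spelling that whole expansion.\<close>

lemma digit_labeling_unique:
  assumes A: "digit_system A" and L: "spectral_labeling L" "digit_sums A \<subseteq> Lambda_labeling L"
  shows "same_labeling L (digit_labeling A)"
proof (rule same_labelingI[OF spectral_labeling_digit_labeling[OF A] L(1)], safe)
  fix v
  show "vertex_word (digit_labeling A) v \<in> range (vertex_word L)"
  \<comment> \<open>The root is separate because \<open>digit_sums\<close> is formed from nonempty
    words.\<close>
  proof (cases "v = []")
    case True
    then have "vertex_word (digit_labeling A) v = vertex_word L []" by (simp add: vertex_word_def)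
    then show ?thesis by simp
  next
    case False
    then have "digit_word A v \<noteq> []" by (metis length_0_conv length_digit_word)
    then have "word_sum (digit_word A v) \<in> Lambda_labeling L"
      using L(2) digit_word_in_digit_words[OF A] by (force simp: digit_sums_eq)
    then obtain p where p: "path_word L [] p = base4_digit (word_sum (digit_word A v))"
      by (auto simp: Lambda_labeling_def)
    have "vertex_word L (map p [0..<length v]) = map (path_word L [] p) [0..<length v]"
      by (simp add: vertex_word_def path_word_def take_map)
    then have "vertex_word (digit_labeling A) v = vertex_word L (map p [0..<length v])"
      by (simp add: p vertex_word_digit_labeling)
    then show ?thesis by simp
  qed
qed

section \<open>The Fourier transform of $\mu_4$\<close>

text \<open>The squared modulus of the Fourier transform of $\mu_4$ at $t$ is the infinite product of
  \<open>cos2 (t / 4 ^ k)\<close> over \<open>k\<close>, because \<open>cos2 t\<close> is the square of $\cos(\pi t/2)$.\<close>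

definition cos2 :: "real \<Rightarrow> real" where
  "cos2 t = (1 + cos (pi * t)) / 2"

lemma cos2_nonneg: "cos2 t \<ge> 0" and cos2_le_1: "cos2 t \<le> 1"
  using cos_ge_minus_one[of "pi * t"] cos_le_one[of "pi * t"] by (simp_all add: cos2_def del: cos_ge_minus_one cos_le_one)

lemma cos_pi_int: "cos (pi * of_int q) = (if even q then 1 else - 1)"
proof (cases "even q")
  case True
  then obtain m where "q = 2 * m" by blast
  then show ?thesis using cos_int_2pin[of m] True by (simp add: mult_ac)
next
  case False
  then obtain m where q: "q = 2 * m + 1" by (rule oddE)
  have "pi * of_int q = (2 * pi) * of_int m + pi" using q by (simp add: algebra_simps)
  then show ?thesis using False by (simp only: cos_periodic_pi cos_int_2pin if_False)
qed

text \<open>The case of odd q is what makes \<open>cos2\<close> a transition probability: the digits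
  0 and a receive probabilities with sum 1.\<close>

lemma cos2_add_int: "cos2 (x + of_int q) = (if even q then cos2 x else 1 - cos2 x)"
proof -
  have "sin (pi * of_int q) = 0" by (simp add: mult.commute)
  then show ?thesis
    using cos_pi_int[of q] by (auto simp: cos2_def ring_distribs cos_add field_simps)
qed

lemma cos2_eq_0_imp_int:
  assumes "cos2 x = 0"
  shows "x \<in> \<int>"
proof -
  have "cos (pi * x) = -1" using assms by (simp add: cos2_def)
  then obtain n :: int where "pi * x = of_int n * pi"
    by (auto simp: cos_eq_minus1) (metis of_int_1 of_int_add of_int_mult of_int_numeral)
  then show ?thesis by simp
qed

lemma expo_add: "expo (s + t) x = expo s x * expo t x"
  by (simp add: expo_def exp_add ring_distribs)

lemma expo_minus: "expo (- t) x = cnj (expo t x)"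
  by (simp add: expo_def exp_cnj)

lemma expo_0 [simp]: "expo 0 x = 1"
  by (simp add: expo_def)

lemma norm_expo [simp]: "cmod (expo t x) = 1"
  by (simp add: expo_def)

lemma continuous_on_expo [continuous_intros]: "continuous_on S (expo t)"
  unfolding expo_def by (intro continuous_intros)

lemma measurable_expo [measurable]: "expo t \<in> borel_measurable borel"
  by (intro borel_measurable_continuous_onI continuous_on_expo)

locale mu4 =
  fixes M :: "real measure"
  assumes is_mu4: "is_mu4 M"

sublocale mu4 \<subseteq> real_distribution M
  using is_mu4 by (simp add: is_mu4_def real_distribution_def real_distribution_axioms_def)

context mu4
begin

text \<open>Extends the defining identity beyond compact supports, since exponentials have none: cut
  off and pass to the limit by dominated convergence.\<close>

lemma invariance_bounded:
  fixes f :: "real \<Rightarrow> complex"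
  assumes cont: "continuous_on UNIV f" and B: "\<And>x. cmod (f x) \<le> B"
  shows "(\<integral>x. f x \<partial>M) = ((\<integral>x. f (x / 4) \<partial>M) + (\<integral>x. f ((x + 2) / 4) \<partial>M)) / 2"
proof -
  \<comment> \<open>Equal to 1 for \<bar>x\<bar> \<le> n and to 0 for \<bar>x\<bar> \<ge> n + 1,
    linear in between.\<close>
  define cut where "cut n x = max 0 (min 1 (real n + 1 - \<bar>x\<bar>))" for n :: nat and x :: real
  define g where "g n x = complex_of_real (cut n x) * f x" for n x
  have B0: "B \<ge> 0" using B[of 0] norm_ge_zero order_trans by blast
  have cut: "\<bar>cut n x\<bar> \<le> 1" for n x by (auto simp: cut_def)
  have cont_g: "continuous_on UNIV (g n)" for n
    unfolding g_def cut_def by (intro continuous_intros cont)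
  have [measurable]: "g n \<in> borel_measurable borel" "f \<in> borel_measurable borel" for n
    by (intro borel_measurable_continuous_onI cont_g cont)+
  have g_eq: "(\<integral>x. g n x \<partial>M) = ((\<integral>x. g n (x / 4) \<partial>M) + (\<integral>x. g n ((x + 2) / 4) \<partial>M)) / 2" for n
  proof -
    have "{x. g n x \<noteq> 0} \<subseteq> cball 0 (real n + 1)"
      by (auto simp: g_def cut_def)
    then have "compact (closure {x. g n x \<noteq> 0})"
      by (meson bounded_cball bounded_subset compact_closure)
    then show ?thesis using is_mu4 cont_g[of n] by (simp add: is_mu4_def)
  qed
  have lim: "(\<lambda>n. \<integral>x. g n (h x) \<partial>M) \<longlonglongrightarrow> (\<integral>x. f (h x) \<partial>M)"
    if [measurable]: "h \<in> borel_measurable borel" for h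
  proof (rule integral_dominated_convergence[where w="\<lambda>_. B"])
    have "(\<lambda>n. g n x) \<longlonglongrightarrow> f x" for x
    proof (rule tendsto_eventually)
      have "g n x = f x" if "n \<ge> nat \<lceil>\<bar>x\<bar>\<rceil>" for n
      proof -
        have "\<bar>x\<bar> \<le> real n" using that by linarith
        then show ?thesis by (simp add: g_def cut_def)
      qed
      then show "\<forall>\<^sub>F n in sequentially. g n x = f x"
        unfolding eventually_sequentially by blast
    qed
    then show "AE x in M. (\<lambda>n. g n (h x)) \<longlonglongrightarrow> f (h x)" by simp
    have "cmod (g n x) \<le> B" for n x
      using mult_mono[OF cut[of n x] B[of x]] B0 by (simp add: g_def norm_mult)
    then show "AE x in M. cmod (g n (h x)) \<le> B" for n by simp
  qed simp_all
  have "(\<lambda>n. \<integral>x. g n x \<partial>M) \<longlonglongrightarrow> ((\<integral>x. f (x / 4) \<partial>M) + (\<integral>x. f ((x + 2) / 4) \<partial>M)) / 2"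
    unfolding g_eq by (intro tendsto_intros lim) simp_all
  moreover have "(\<lambda>n. \<integral>x. g n x \<partial>M) \<longlonglongrightarrow> (\<integral>x. f x \<partial>M)"
    using lim[of "\<lambda>x. x"] by simp
  ultimately show ?thesis by (rule LIMSEQ_unique[rotated])
qed

text \<open>The function \<open>g\<close> in the proof is an increasing function of the distance to the unit interval,
  which both maps of the iterated function system contract.\<close>

lemma AE_unit_interval: "AE x in M. x \<in> {0..1}"
proof -
  define u where "u x = max 0 (max (- x) (x - 1))" for x :: real
  \<comment> \<open>The quotient is bounded, so that \<open>invariance_bounded\<close> applies, and
    still strictly increasing in u.\<close>
  define g where "g x = u x / (1 + u x)" for x
  have u0: "u x \<ge> 0" for x by (simp add: u_def)
  have g01: "0 \<le> g x" "g x \<le> 1" for x using u0[of x] by (auto simp: g_def field_simps)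
  have mono: "g x \<le> g y" if "u x \<le> u y" for x y
    using that u0[of x] u0[of y] by (auto simp: g_def field_simps)
  have strict: "g x < g y" if "u x < u y" for x y
    using that u0[of x] u0[of y] by (auto simp: g_def field_simps)
  have cont: "continuous_on UNIV g"
    unfolding g_def u_def by (intro continuous_intros) (auto simp: add_nonneg_eq_0_iff)
  then have [measurable]: "g \<in> borel_measurable borel" by (rule borel_measurable_continuous_onI)
  have int: "integrable M (\<lambda>x. g (k x))" if [measurable]: "k \<in> borel_measurable borel" for k
    using g01 by (intro integrable_const_bound[of _ 1]) auto
  have "complex_of_real (\<integral>x. g x \<partial>M) =
      complex_of_real (((\<integral>x. g (x / 4) \<partial>M) + (\<integral>x. g ((x + 2) / 4) \<partial>M)) / 2)"
    using invariance_bounded[of "\<lambda>x. complex_of_real (g x)" 1] g01 cont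
    by (simp add: continuous_on_of_real)
  then have eq: "(\<integral>x. g x \<partial>M) = ((\<integral>x. g (x / 4) \<partial>M) + (\<integral>x. g ((x + 2) / 4) \<partial>M)) / 2"
    unfolding of_real_eq_iff .
  \<comment> \<open>By invariance d has integral 0. It is nonnegative, and positive off the unit
    interval, which must therefore carry all the mass.\<close>
  define d where "d x = g x - (g (x / 4) + g ((x + 2) / 4)) / 2" for x
  have "integrable M d"
    unfolding d_def by (intro Bochner_Integration.integrable_diff Bochner_Integration.integrable_add
        integrable_divide int) simp_all
  moreover have "(\<integral>x. d x \<partial>M) = 0"
    unfolding d_def using int[of "\<lambda>x. x"] int[of "\<lambda>x. x / 4"] int[of "\<lambda>x. (x + 2) / 4"] eq by simp
  moreover have "d x \<ge> 0" for x
  proof -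
    have "u (x / 4) \<le> u x" "u ((x + 2) / 4) \<le> u x" by (auto simp: u_def max_def)
    then have "g (x / 4) \<le> g x" "g ((x + 2) / 4) \<le> g x" by (simp_all add: mono)
    then show ?thesis by (simp add: d_def)
  qed
  ultimately have "AE x in M. d x = 0"
    using integral_nonneg_eq_0_iff_AE[of M d] by simp
  moreover have "x \<in> {0..1}" if "d x = 0" for x
  proof (rule ccontr)
    assume "x \<notin> {0..1}"
    then have "u (x / 4) < u x" "u ((x + 2) / 4) < u x" by (auto simp: u_def max_def)
    then show False using that strict[of "x / 4" x] strict[of "(x + 2) / 4" x] by (simp add: d_def)
  qed
  ultimately show ?thesis by (rule eventually_mono)
qed

definition ft :: "real \<Rightarrow> complex" where
  "ft t = (\<integral>x. expo t x \<partial>M)"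

definition ft2 :: "real \<Rightarrow> real" where
  "ft2 t = (cmod (ft t))\<^sup>2"

section \<open>Functional equation and zeros of the Fourier transform\<close>

lemma ft_eq_char: "ft t = char M (2 * pi * t)"
  by (simp add: ft_def char_def expo_def mult_ac)

lemma ft_rec: "ft t = (1 + exp (\<i> * complex_of_real (pi * t))) / 2 * ft (t / 4)"
proof -
  have 1: "expo t (x / 4) = expo (t / 4) x" for x
    by (simp add: expo_def mult_ac)
  have 2: "expo t ((x + 2) / 4) = exp (\<i> * complex_of_real (pi * t)) * expo (t / 4) x" for x
    by (simp add: expo_def exp_add[symmetric] algebra_simps add_divide_distrib)
  have "ft t = ((\<integral>x. expo t (x / 4) \<partial>M) + (\<integral>x. expo t ((x + 2) / 4) \<partial>M)) / 2"
    unfolding ft_def by (rule invariance_bounded[of _ 1]) (simp_all add: continuous_on_expo)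
  also have "\<dots> = (ft (t / 4) + exp (\<i> * complex_of_real (pi * t)) * ft (t / 4)) / 2"
    unfolding ft_def 2 unfolding 1 by simp
  finally show ?thesis by (simp add: field_simps)
qed

lemma ft2_rec: "ft2 t = cos2 t * ft2 (t / 4)"
proof -
  have "(cmod ((1 + exp (\<i> * complex_of_real (pi * t))) / 2))\<^sup>2
      = ((1 + cos (pi * t))\<^sup>2 + (sin (pi * t))\<^sup>2) / 4"
    by (simp add: norm_divide power_divide cmod_power2 Re_exp Im_exp)
  also have "\<dots> = cos2 t"
    unfolding cos2_def sin_squared_eq by (simp add: power2_eq_square algebra_simps)
  finally show ?thesis
    unfolding ft2_def by (subst ft_rec) (simp only: norm_mult power_mult_distrib)
qed

lemma ft2_iterate: "ft2 t = (\<Prod>k<n. cos2 (t / 4 ^ k)) * ft2 (t / 4 ^ n)"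
proof (induction n)
  case (Suc n)
  then show ?case using ft2_rec[of "t / 4 ^ n"] by (simp add: field_simps)
qed simp

lemma ft2_0: "ft2 0 = 1"
  using char_zero by (simp add: ft2_def ft_eq_char)

lemma ft2_le_1: "ft2 t \<le> 1"
  using cmod_char_le_1[of "2 * pi * t"] by (simp add: ft2_def ft_eq_char power_le_one)

lemma isCont_ft2: "isCont ft2 t"
  unfolding ft2_def[abs_def] ft_eq_char
  by (intro continuous_intros isCont_o2[OF _ isCont_char])

lemma continuous_on_ft2: "continuous_on S ft2"
  by (intro continuous_at_imp_continuous_on ballI isCont_ft2)

lemma ft2_tendsto_1: "(\<lambda>n. ft2 (t / 4 ^ n)) \<longlonglongrightarrow> 1"
proof -
  have "(\<lambda>n. t * (1 / 4) ^ n) \<longlonglongrightarrow> t * 0"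
    by (intro tendsto_mult tendsto_const LIMSEQ_power_zero) simp
  then have "(\<lambda>n. t / 4 ^ n) \<longlonglongrightarrow> 0" by (simp add: power_divide)
  from isCont_tendsto_compose[OF isCont_ft2 this] show ?thesis by (simp add: ft2_0)
qed

text \<open>The tail of the infinite product is close to 1, and a factor
  \<open>cos2 (t / 4 ^ k)\<close> can vanish only if t is an integer.\<close>

lemma ft2_pos:
  assumes "t \<notin> \<int> \<or> t = 0"
  shows "ft2 t > 0"
proof (cases "t = 0")
  case False
  then have t: "t \<notin> \<int>" using assms by blast
  obtain n where n: "ft2 (t / 4 ^ n) > 0"
    using order_tendstoD(1)[OF ft2_tendsto_1[of t], of 0] by (auto simp: eventually_sequentially)
  have "cos2 (t / 4 ^ k) > 0" for k
  proof (rule ccontr)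
    assume "\<not> cos2 (t / 4 ^ k) > 0"
    then have "t / 4 ^ k \<in> \<int>"
      using cos2_nonneg[of "t / 4 ^ k"] cos2_eq_0_imp_int by auto
    then have "t / 4 ^ k * 4 ^ k \<in> \<int>" by (intro Ints_mult Ints_power) auto
    then show False using t by simp
  qed
  then show ?thesis using n by (subst ft2_iterate[of t n]) (simp add: prod_pos)
qed (simp add: ft2_0)

text \<open>The factor with index k is \<open>cos2 q\<close>, which is 0 for odd q.\<close>

lemma ft2_eq_0:
  assumes "odd q"
  shows "ft2 (of_int (4 ^ k * q)) = 0"
  using assms cos_pi_int[of q]
  by (subst ft2_iterate[of _ "Suc k"]) (simp add: cos2_def)

lemma integrable_expo: "integrable M (expo t)"
  by (intro integrable_const_bound[of _ 1]) auto

lemma expo_in_L2: "expo t \<in> L2 M"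
  by (auto simp: L2_def)

lemma L2_inner_expo: "L2_inner M (expo s) (expo t) = ft (s - t)"
  unfolding L2_inner_def ft_def
  by (simp add: expo_minus[symmetric] expo_add[symmetric])

lemma L2_norm_expo: "L2_norm M (expo t) = 1"
  using prob_space by (simp add: L2_norm_def)

lemma orthogonal_Lambda_digits:
  assumes "digit_system A"
  shows "orthogonal_family M expo (real_of_int ` Lambda_digits A)"
proof -
  have "ft (of_int l - of_int l') = 0"
    if l: "l \<in> Lambda_digits A" "l' \<in> Lambda_digits A" "l \<noteq> l'" for l l'
  proof -
    obtain k q where "odd q" "l - l' = 4 ^ k * q" using Lambda_digits_diff[OF assms l] by blast
    then have "ft2 (of_int (l - l')) = 0" using ft2_eq_0 by simp
    then show ?thesis by (simp add: ft2_def)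
  qed
  then show ?thesis by (auto simp: orthogonal_family_def L2_inner_expo expo_in_L2)
qed

end

section \<open>Closed linear spans in $L^2$\<close>

locale L2_family = prob_space M
  for M :: "'a measure" and b :: "'i \<Rightarrow> 'a \<Rightarrow> complex" and I :: "'i set" +
  assumes b_in_L2: "i \<in> I \<Longrightarrow> b i \<in> L2 M"
begin

lemma L2_measurable: "f \<in> L2 M \<Longrightarrow> f \<in> borel_measurable M"
  and L2_integrable: "f \<in> L2 M \<Longrightarrow> integrable M (\<lambda>x. (cmod (f x))\<^sup>2)"
  by (auto simp: L2_def)

lemma L2_scale: "f \<in> L2 M \<Longrightarrow> (\<lambda>x. c * f x) \<in> L2 M"
  by (auto simp: L2_def norm_mult power_mult_distrib)

lemma cmod_add_squared: "(cmod (u + v))\<^sup>2 \<le> 2 * (cmod u)\<^sup>2 + 2 * (cmod v)\<^sup>2"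
proof -
  have "(cmod (u + v))\<^sup>2 \<le> (cmod u + cmod v)\<^sup>2"
    by (intro power_mono norm_triangle_ineq) simp
  also have "\<dots> \<le> 2 * (cmod u)\<^sup>2 + 2 * (cmod v)\<^sup>2"
    using zero_le_power2[of "cmod u - cmod v"] by (simp add: power2_sum power2_diff)
  finally show ?thesis .
qed

lemma L2_add:
  assumes f: "f \<in> L2 M" and g: "g \<in> L2 M"
  shows "(\<lambda>x. f x + g x) \<in> L2 M"
    and "(\<integral>x. (cmod (f x + g x))\<^sup>2 \<partial>M) \<le> 2 * (\<integral>x. (cmod (f x))\<^sup>2 \<partial>M) + 2 * (\<integral>x. (cmod (g x))\<^sup>2 \<partial>M)"
proof -
  note [measurable] = L2_measurable[OF f] L2_measurable[OF g]
  have int: "integrable M (\<lambda>x. 2 * (cmod (f x))\<^sup>2 + 2 * (cmod (g x))\<^sup>2)"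
    using L2_integrable[OF f] L2_integrable[OF g] by simp
  have sum_int: "integrable M (\<lambda>x. (cmod (f x + g x))\<^sup>2)"
    by (rule Bochner_Integration.integrable_bound[OF int])
       (use cmod_add_squared in \<open>auto intro: abs_of_nonneg[THEN ord_eq_le_trans]\<close>)
  then show "(\<lambda>x. f x + g x) \<in> L2 M" by (simp add: L2_def)
  have "(\<integral>x. (cmod (f x + g x))\<^sup>2 \<partial>M) \<le> (\<integral>x. 2 * (cmod (f x))\<^sup>2 + 2 * (cmod (g x))\<^sup>2 \<partial>M)"
    by (intro integral_mono sum_int int cmod_add_squared)
  also have "\<dots> = 2 * (\<integral>x. (cmod (f x))\<^sup>2 \<partial>M) + 2 * (\<integral>x. (cmod (g x))\<^sup>2 \<partial>M)"
    using L2_integrable[OF f] L2_integrable[OF g] by simp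
  finally show "(\<integral>x. (cmod (f x + g x))\<^sup>2 \<partial>M) \<le>
    2 * (\<integral>x. (cmod (f x))\<^sup>2 \<partial>M) + 2 * (\<integral>x. (cmod (g x))\<^sup>2 \<partial>M)" .
qed

lemma L2_diff: "f \<in> L2 M \<Longrightarrow> g \<in> L2 M \<Longrightarrow> (\<lambda>x. f x - g x) \<in> L2 M"
  using L2_add(1)[of f "\<lambda>x. -1 * g x"] L2_scale[of g "-1"] by simp

lemma bounded_in_L2:
  assumes [measurable]: "f \<in> borel_measurable M" and "\<And>x. cmod (f x) \<le> B"
  shows "f \<in> L2 M"
proof -
  have "integrable M (\<lambda>x. (cmod (f x))\<^sup>2)"
    using assms(2) by (intro integrable_const_bound[of _ "B\<^sup>2"]) (auto intro!: power_mono)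
  then show ?thesis by (simp add: L2_def)
qed

definition lincomb :: "('a \<Rightarrow> complex) set" where
  "lincomb = {(\<lambda>x. \<Sum>i\<in>F. c i * b i x) | F c. finite F \<and> F \<subseteq> I}"

text \<open>The closure of the span in L2. Squared distances are used, so that \<open>L2_add\<close>
  takes the place of the triangle inequality for the norm.\<close>

definition closed_span :: "('a \<Rightarrow> complex) set" where
  "closed_span = {f \<in> L2 M. \<forall>\<epsilon>>0. \<exists>g\<in>lincomb. (\<integral>x. (cmod (f x - g x))\<^sup>2 \<partial>M) < \<epsilon>}"

lemma lincombI: "finite F \<Longrightarrow> F \<subseteq> I \<Longrightarrow> (\<lambda>x. \<Sum>i\<in>F. c i * b i x) \<in> lincomb"
  by (auto simp: lincomb_def)

lemma lincomb_in_L2: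
  assumes "f \<in> lincomb"
  shows "f \<in> L2 M"
proof -
  have "(\<lambda>x. \<Sum>i\<in>F. c i * b i x) \<in> L2 M" if "finite F" "F \<subseteq> I" for F c
    using that
  proof (induction F)
    case empty
    then show ?case by (simp add: bounded_in_L2[of _ 0])
  next
    case (insert i F)
    then have "(\<lambda>x. c i * b i x + (\<Sum>i\<in>F. c i * b i x)) \<in> L2 M"
      by (intro L2_add(1) L2_scale b_in_L2) auto
    with insert show ?case by simp
  qed
  then show ?thesis using assms by (auto simp: lincomb_def)
qed

lemma lincomb_scale:
  assumes "f \<in> lincomb"
  shows "(\<lambda>x. a * f x) \<in> lincomb"
proof -
  obtain F c where F: "finite F" "F \<subseteq> I" "f = (\<lambda>x. \<Sum>i\<in>F. c i * b i x)"
    using assms by (auto simp: lincomb_def)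
  then have "(\<lambda>x. a * f x) = (\<lambda>x. \<Sum>i\<in>F. (a * c i) * b i x)"
    by (simp add: sum_distrib_left mult.assoc)
  then show ?thesis using lincombI[OF F(1,2), of "\<lambda>i. a * c i"] by simp
qed

lemma lincomb_add:
  assumes "f \<in> lincomb" "g \<in> lincomb"
  shows "(\<lambda>x. f x + g x) \<in> lincomb"
proof -
  obtain F c where F: "finite F" "F \<subseteq> I" "f = (\<lambda>x. \<Sum>i\<in>F. c i * b i x)"
    using assms(1) by (auto simp: lincomb_def)
  obtain G d where G: "finite G" "G \<subseteq> I" "g = (\<lambda>x. \<Sum>i\<in>G. d i * b i x)"
    using assms(2) by (auto simp: lincomb_def)
  \<comment> \<open>Both coefficient families are extended by 0 to the union of the index
    sets.\<close>
  have "f x + g x = (\<Sum>i\<in>F \<union> G. ((if i \<in> F then c i else 0) + (if i \<in> G then d i else 0)) * b i x)" for x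
  proof -
    have "f x = (\<Sum>i\<in>F \<union> G. (if i \<in> F then c i else 0) * b i x)"
      unfolding F(3) using F(1) G(1) by (intro sum.mono_neutral_cong_left) auto
    moreover have "g x = (\<Sum>i\<in>F \<union> G. (if i \<in> G then d i else 0) * b i x)"
      unfolding G(3) using F(1) G(1) by (intro sum.mono_neutral_cong_left) auto
    ultimately show ?thesis by (simp add: sum.distrib ring_distribs)
  qed
  then show ?thesis
    using lincombI[of "F \<union> G" "\<lambda>i. (if i \<in> F then c i else 0) + (if i \<in> G then d i else 0)"] F G
    by simp
qed

lemma closed_span_in_L2: "f \<in> closed_span \<Longrightarrow> f \<in> L2 M"
  by (simp add: closed_span_def)

lemma closed_spanE:
  assumes "f \<in> closed_span" "\<epsilon> > 0"
  obtains g where "g \<in> lincomb" "(\<integral>x. (cmod (f x - g x))\<^sup>2 \<partial>M) < \<epsilon>"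
  using assms by (auto simp: closed_span_def)

lemma closed_span_closed:
  assumes f: "f \<in> L2 M" and approx: "\<And>\<epsilon>. \<epsilon> > 0 \<Longrightarrow> \<exists>g\<in>closed_span. (\<integral>x. (cmod (f x - g x))\<^sup>2 \<partial>M) < \<epsilon>"
  shows "f \<in> closed_span"
  unfolding closed_span_def
proof (safe intro!: f)
  fix \<epsilon> :: real assume \<epsilon>: "\<epsilon> > 0"
  \<comment> \<open>\<open>L2_add\<close> doubles both errors, hence \<epsilon> / 4 for
    each.\<close>
  obtain g where g: "g \<in> closed_span" "(\<integral>x. (cmod (f x - g x))\<^sup>2 \<partial>M) < \<epsilon> / 4"
    using approx[of "\<epsilon> / 4"] \<epsilon> by auto
  obtain h where h: "h \<in> lincomb" "(\<integral>x. (cmod (g x - h x))\<^sup>2 \<partial>M) < \<epsilon> / 4"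
    using closed_spanE[OF g(1), of "\<epsilon> / 4"] \<epsilon> by auto
  have "(\<integral>x. (cmod ((f x - g x) + (g x - h x)))\<^sup>2 \<partial>M) \<le>
      2 * (\<integral>x. (cmod (f x - g x))\<^sup>2 \<partial>M) + 2 * (\<integral>x. (cmod (g x - h x))\<^sup>2 \<partial>M)"
    by (intro L2_add(2) L2_diff f closed_span_in_L2[OF g(1)] lincomb_in_L2[OF h(1)])
  then have "(\<integral>x. (cmod (f x - h x))\<^sup>2 \<partial>M) < \<epsilon>"
    using g(2) h(2) by simp
  then show "\<exists>g\<in>lincomb. (\<integral>x. (cmod (f x - g x))\<^sup>2 \<partial>M) < \<epsilon>"
    using h(1) by blast
qed

lemma closed_span_add:
  assumes f: "f \<in> closed_span" and g: "g \<in> closed_span"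
  shows "(\<lambda>x. f x + g x) \<in> closed_span"
  unfolding closed_span_def
proof (safe intro!: L2_add(1)[OF closed_span_in_L2[OF f] closed_span_in_L2[OF g]])
  fix \<epsilon> :: real assume \<epsilon>: "\<epsilon> > 0"
  obtain f' where f': "f' \<in> lincomb" "(\<integral>x. (cmod (f x - f' x))\<^sup>2 \<partial>M) < \<epsilon> / 4"
    using closed_spanE[OF f, of "\<epsilon> / 4"] \<epsilon> by auto
  obtain g' where g': "g' \<in> lincomb" "(\<integral>x. (cmod (g x - g' x))\<^sup>2 \<partial>M) < \<epsilon> / 4"
    using closed_spanE[OF g, of "\<epsilon> / 4"] \<epsilon> by auto
  have "(\<integral>x. (cmod ((f x - f' x) + (g x - g' x)))\<^sup>2 \<partial>M) \<le>
      2 * (\<integral>x. (cmod (f x - f' x))\<^sup>2 \<partial>M) + 2 * (\<integral>x. (cmod (g x - g' x))\<^sup>2 \<partial>M)"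
    by (intro L2_add(2) L2_diff closed_span_in_L2[OF f] closed_span_in_L2[OF g]
        lincomb_in_L2[OF f'(1)] lincomb_in_L2[OF g'(1)])
  then have "(\<integral>x. (cmod ((f x + g x) - (f' x + g' x)))\<^sup>2 \<partial>M) < \<epsilon>"
    using f'(2) g'(2) by (simp add: add_diff_add)
  then show "\<exists>h\<in>lincomb. (\<integral>x. (cmod ((f x + g x) - h x))\<^sup>2 \<partial>M) < \<epsilon>"
    by (rule bexI[OF _ lincomb_add[OF f'(1) g'(1)]])
qed

lemma closed_span_scale:
  assumes f: "f \<in> closed_span"
  shows "(\<lambda>x. a * f x) \<in> closed_span"
  unfolding closed_span_def
proof (safe intro!: L2_scale[OF closed_span_in_L2[OF f]])
  fix \<epsilon> :: real assume \<epsilon>: "\<epsilon> > 0"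
  \<comment> \<open>Adding 1 allows division by k also when a = 0.\<close>
  define k where "k = 1 + (cmod a)\<^sup>2"
  have k: "k > 0" by (simp add: k_def add_pos_nonneg)
  obtain g where g: "g \<in> lincomb" "(\<integral>x. (cmod (f x - g x))\<^sup>2 \<partial>M) < \<epsilon> / k"
    using closed_spanE[OF f, of "\<epsilon> / k"] \<epsilon> k by auto
  have "(\<integral>x. (cmod (a * f x - a * g x))\<^sup>2 \<partial>M) = (cmod a)\<^sup>2 * (\<integral>x. (cmod (f x - g x))\<^sup>2 \<partial>M)"
    by (simp add: norm_mult power_mult_distrib flip: right_diff_distrib)
  also have "\<dots> \<le> k * (\<integral>x. (cmod (f x - g x))\<^sup>2 \<partial>M)"
    by (intro mult_right_mono) (auto simp: k_def)
  also have "\<dots> < \<epsilon>" using g(2) k by (simp add: field_simps)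
  finally show "\<exists>h\<in>lincomb. (\<integral>x. (cmod (a * f x - h x))\<^sup>2 \<partial>M) < \<epsilon>"
    by (rule bexI[OF _ lincomb_scale[OF g(1)]])
qed

lemma closed_span_zero: "(\<lambda>_. 0) \<in> closed_span"
proof -
  have "(\<lambda>_. 0) \<in> lincomb" using lincombI[of "{}"] by simp
  moreover from this have "(\<lambda>_. 0) \<in> L2 M" by (rule lincomb_in_L2)
  ultimately show ?thesis by (force simp: closed_span_def)
qed

lemma closed_span_sum:
  assumes "finite J" "\<And>j. j \<in> J \<Longrightarrow> f j \<in> closed_span"
  shows "(\<lambda>x. \<Sum>j\<in>J. f j x) \<in> closed_span"
  using assms by (induction J) (auto simp: closed_span_zero intro: closed_span_add)

lemma closed_span_dominated_limit:
  assumes f: "f \<in> L2 M" and s: "\<And>n. s n \<in> closed_span"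
    and lim: "\<And>x. x \<in> space M \<Longrightarrow> (\<lambda>n. s n x) \<longlonglongrightarrow> f x"
    and w: "integrable M w" and bound: "\<And>n x. x \<in> space M \<Longrightarrow> (cmod (f x - s n x))\<^sup>2 \<le> w x"
  shows "f \<in> closed_span"
proof (rule closed_span_closed[OF f])
  fix \<epsilon> :: real assume \<epsilon>: "\<epsilon> > 0"
  note [measurable] = L2_measurable[OF f] L2_measurable[OF closed_span_in_L2[OF s]]
  have "(\<lambda>n. \<integral>x. (cmod (f x - s n x))\<^sup>2 \<partial>M) \<longlonglongrightarrow> (\<integral>x. 0 \<partial>M)"
  proof (rule integral_dominated_convergence[where w=w])
    have "(\<lambda>n. (cmod (f x - s n x))\<^sup>2) \<longlonglongrightarrow> (cmod (f x - f x))\<^sup>2" if "x \<in> space M" for x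
      by (intro tendsto_intros lim that)
    then show "AE x in M. (\<lambda>n. (cmod (f x - s n x))\<^sup>2) \<longlonglongrightarrow> 0" by simp
    show "AE x in M. norm ((cmod (f x - s n x))\<^sup>2) \<le> w x" for n using bound by simp
  qed (use w in simp_all)
  then have "(\<lambda>n. \<integral>x. (cmod (f x - s n x))\<^sup>2 \<partial>M) \<longlonglongrightarrow> 0" by simp
  from order_tendstoD(2)[OF this \<epsilon>]
  show "\<exists>g\<in>closed_span. (\<integral>x. (cmod (f x - g x))\<^sup>2 \<partial>M) < \<epsilon>"
    using s by (auto simp: eventually_sequentially)
qed

lemma closed_span_bounded_limit:
  assumes s: "\<And>n. s n \<in> closed_span" and B: "\<And>n x. cmod (s n x) \<le> B"
    and lim: "\<And>x. (\<lambda>n. s n x) \<longlonglongrightarrow> f x"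
  shows "f \<in> closed_span"
proof (rule closed_span_dominated_limit[OF _ s lim])
  have fB: "cmod (f x) \<le> B" for x
    using B by (intro tendsto_upperbound[OF tendsto_norm[OF lim]]) auto
  have "f \<in> borel_measurable M"
    by (rule borel_measurable_LIMSEQ_metric[OF L2_measurable[OF closed_span_in_L2[OF s]] lim])
  then show "f \<in> L2 M" using fB by (rule bounded_in_L2)
  show "(cmod (f x - s n x))\<^sup>2 \<le> (2 * B)\<^sup>2" for n x
    using norm_triangle_ineq4[of "f x" "s n x"] fB[of x] B[of n x]
    by (intro power_mono) auto
qed simp

lemma closed_span_eq_L2:
  assumes ind: "\<And>S. S \<in> sets M \<Longrightarrow> indicator S \<in> closed_span"
  shows "closed_span = L2 M"
proof (intro equalityI subsetI closed_span_in_L2)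
  fix f assume f: "f \<in> L2 M"
  obtain s where s: "\<And>n. simple_function M (s n)"
    "\<And>x. x \<in> space M \<Longrightarrow> (\<lambda>n. s n x) \<longlonglongrightarrow> f x"
    "\<And>n x. x \<in> space M \<Longrightarrow> cmod (s n x) \<le> 2 * cmod (f x)"
    using borel_measurable_implies_sequence_metric[OF L2_measurable[OF f], of 0] by simp metis
  \<comment> \<open>The simple function s n written as a linear combination of indicators, so that
    \<open>closed_span_sum\<close> applies; agreement is claimed on \<open>space M\<close>
    only.\<close>
  define t where "t n x = (\<Sum>y\<in>s n ` space M. y * indicator (s n -` {y} \<inter> space M) x)" for n x
  have t_eq: "t n x = s n x" if "x \<in> space M" for n x
  proof -
    have fin: "finite (s n ` space M)" using s(1)[of n] by (simp add: simple_function_def)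
    have "t n x = (\<Sum>y\<in>s n ` space M. if y = s n x then y else 0)"
      unfolding t_def using that by (intro sum.cong) (auto simp: indicator_def)
    then show ?thesis using that fin by simp
  qed
  show "f \<in> closed_span"
  proof (rule closed_span_dominated_limit[OF f])
    show "t n \<in> closed_span" for n
      unfolding t_def[abs_def] using s(1)[of n]
      by (intro closed_span_sum closed_span_scale ind) (auto simp: simple_function_def)
    show "(\<lambda>n. t n x) \<longlonglongrightarrow> f x" if "x \<in> space M" for x
      using s(2)[OF that] by (simp add: t_eq[OF that])
    \<comment> \<open>From the bound of s n by twice the modulus of f: (1 + 2)^2 = 9.\<close>
    show "integrable M (\<lambda>x. 9 * (cmod (f x))\<^sup>2)" using L2_integrable[OF f] by simp
    show "(cmod (f x - t n x))\<^sup>2 \<le> 9 * (cmod (f x))\<^sup>2" if "x \<in> space M" for n x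
    proof -
      have "cmod (f x - t n x) \<le> 3 * cmod (f x)"
        using norm_triangle_ineq4[of "f x" "s n x"] s(3)[OF that, of n] by (simp add: t_eq[OF that])
      then have "(cmod (f x - t n x))\<^sup>2 \<le> (3 * cmod (f x))\<^sup>2" by (intro power_mono) auto
      then show ?thesis by (simp add: power_mult_distrib)
    qed
  qed
qed

end

section \<open>Totality of the exponentials\<close>

inductive trig_poly :: "(real \<Rightarrow> complex) \<Rightarrow> bool" where
  trig_poly_expo: "trig_poly (expo t)"
| trig_poly_scale: "trig_poly f \<Longrightarrow> trig_poly (\<lambda>x. c * f x)"
| trig_poly_add: "trig_poly f \<Longrightarrow> trig_poly g \<Longrightarrow> trig_poly (\<lambda>x. f x + g x)"

lemma trig_poly_mult_expo:
  assumes "trig_poly g"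
  shows "trig_poly (\<lambda>x. expo t x * g x)"
  using assms
proof induction
  case (trig_poly_expo s)
  then show ?case using trig_poly.trig_poly_expo[of "t + s"] by (simp add: expo_add[abs_def])
next
  case (trig_poly_scale f c)
  from trig_poly.trig_poly_scale[OF this(2), of c] show ?case by (simp add: mult_ac)
next
  case (trig_poly_add f g)
  from trig_poly.trig_poly_add[OF this(3,4)] show ?case by (simp add: ring_distribs)
qed

lemma trig_poly_mult:
  assumes "trig_poly f" "trig_poly g"
  shows "trig_poly (\<lambda>x. f x * g x)"
  using assms(1)
proof induction
  case (trig_poly_expo t)
  then show ?case using trig_poly_mult_expo[OF assms(2)] .
next
  case (trig_poly_scale f c)
  from trig_poly.trig_poly_scale[OF this(2), of c] show ?case by (simp add: mult_ac)
next
  case (trig_poly_add f h)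
  from trig_poly.trig_poly_add[OF this(3,4)] show ?case by (simp add: ring_distribs)
qed

lemma continuous_on_trig_poly: "trig_poly f \<Longrightarrow> continuous_on S f"
  by (induction rule: trig_poly.induct) (auto intro: continuous_intros)

lemma trig_poly_approx:
  fixes f :: "real \<Rightarrow> real"
  assumes "continuous_on {0..1} f" "\<epsilon> > 0"
  obtains g where "trig_poly g" "\<And>x. x \<in> {0..1} \<Longrightarrow> cmod (complex_of_real (f x) - g x) < \<epsilon>"
proof -
  define P where "P f \<longleftrightarrow> trig_poly (\<lambda>x. complex_of_real (f x))" for f :: "real \<Rightarrow> real"
  have "\<exists>g. P g \<and> (\<forall>x\<in>{0..1}. \<bar>f x - g x\<bar> < \<epsilon>)"
  proof (rule Stone_Weierstrass_HOL[where P=P])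
    show "P (\<lambda>x. c)" for c
      using trig_poly_scale[OF trig_poly_expo[of 0], of c] by (simp add: P_def)
    show "continuous_on {0..1} h" if "P h" for h
      using continuous_on_Re[OF continuous_on_trig_poly[OF that[unfolded P_def]]] by simp
    show "P (\<lambda>x. g x + h x)" if "P g \<and> P h" for g h
      using that by (auto simp: P_def dest: trig_poly_add)
    show "P (\<lambda>x. g x * h x)" if "P g \<and> P h" for g h
      using that by (auto simp: P_def dest: trig_poly_mult)
    show "\<exists>h. P h \<and> h x \<noteq> h y" if xy: "x \<in> {0..1} \<and> y \<in> {0..1} \<and> x \<noteq> y" for x y
    proof (intro exI conjI)
      \<comment> \<open>The frequencies 1/4 and -1/4 give a cosine that is injective on the unit
        interval, so one function separates all points.\<close>
      have "complex_of_real (cos (pi * x / 2)) = 1 / 2 * (expo (1 / 4) x + expo (- 1 / 4) x)" for x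
        by (simp add: cos_of_real[symmetric] cos_exp_eq expo_def mult_ac)
      then show "P (\<lambda>x. cos (pi * x / 2))"
        unfolding P_def by (simp only:) (intro trig_poly.intros)
      have "arccos (cos (pi * z / 2)) = pi * z / 2" if "z \<in> {0..1}" for z
        using that mult_left_le[of z pi] pi_gt_zero by (intro arccos_cos) auto
      from this[of x] this[of y] show "cos (pi * x / 2) \<noteq> cos (pi * y / 2)" using xy by auto
    qed
  qed (use assms in auto)
  then obtain g where "P g" and g: "\<And>x. x \<in> {0..1} \<Longrightarrow> \<bar>f x - g x\<bar> < \<epsilon>" by blast
  show ?thesis
  proof (rule that)
    show "trig_poly (\<lambda>x. complex_of_real (g x))" using \<open>P g\<close> by (simp add: P_def)
    show "cmod (complex_of_real (f x) - complex_of_real (g x)) < \<epsilon>" if "x \<in> {0..1}" for x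
      using g[OF that] by (simp flip: of_real_diff)
  qed
qed

locale mu4_exponentials = mu4 M for M +
  fixes \<Lambda> :: "real set"

sublocale mu4_exponentials \<subseteq> L2_family M expo \<Lambda>
  by standard (rule expo_in_L2)

context mu4_exponentials
begin

context
  assumes expo_in_closed_span: "\<And>t. expo t \<in> closed_span"
begin

lemma trig_poly_in_closed_span: "trig_poly f \<Longrightarrow> f \<in> closed_span"
  by (induction rule: trig_poly.induct)
     (auto intro: expo_in_closed_span closed_span_scale closed_span_add)

text \<open>Uniform approximation on the unit interval is enough, because the measure lives
  there.\<close>

lemma continuous_in_closed_span:
  fixes f :: "real \<Rightarrow> real"
  assumes f: "continuous_on UNIV f" "\<And>x. \<bar>f x\<bar> \<le> B"
  shows "(\<lambda>x. complex_of_real (f x)) \<in> closed_span"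
proof (rule closed_span_closed)
  have [measurable]: "f \<in> borel_measurable borel" using f(1) by (rule borel_measurable_continuous_onI)
  show L2: "(\<lambda>x. complex_of_real (f x)) \<in> L2 M"
    using f(2) by (intro bounded_in_L2) auto
  fix \<epsilon> :: real assume \<epsilon>: "\<epsilon> > 0"
  obtain g where g: "trig_poly g" "\<And>x. x \<in> {0..1} \<Longrightarrow> cmod (complex_of_real (f x) - g x) < sqrt (\<epsilon> / 2)"
    using trig_poly_approx[of f "sqrt (\<epsilon> / 2)"] f(1) \<epsilon> continuous_on_subset by (metis half_gt_zero real_sqrt_gt_zero subset_UNIV)
  have gc: "g \<in> closed_span" using g(1) by (rule trig_poly_in_closed_span)
  have "(\<integral>x. (cmod (complex_of_real (f x) - g x))\<^sup>2 \<partial>M) \<le> (\<integral>x. \<epsilon> / 2 \<partial>M)"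
  proof (rule integral_mono_AE)
    show "integrable M (\<lambda>x. (cmod (complex_of_real (f x) - g x))\<^sup>2)"
      by (rule L2_integrable[OF L2_diff[OF L2 closed_span_in_L2[OF gc]]])
    have "(cmod (complex_of_real (f x) - g x))\<^sup>2 \<le> \<epsilon> / 2" if "x \<in> {0..1}" for x
      using power_mono[OF less_imp_le[OF g(2)[OF that]], of 2] \<epsilon> by simp
    with AE_unit_interval show "AE x in M. (cmod (complex_of_real (f x) - g x))\<^sup>2 \<le> \<epsilon> / 2"
      by (rule eventually_mono)
  qed simp
  also have "\<dots> < \<epsilon>" using \<epsilon> prob_space by simp
  finally show "\<exists>g\<in>closed_span. (\<integral>x. (cmod (complex_of_real (f x) - g x))\<^sup>2 \<partial>M) < \<epsilon>"
    using gc by blast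
qed

lemma halfline_in_closed_span: "indicator {..a} \<in> closed_span"
proof (rule closed_span_bounded_limit)
  \<comment> \<open>For n > 0 this is 1 up to a and falls linearly to 0 on the interval from a to a
    + 1 / n.\<close>
  define g where "g n x = max 0 (min 1 (1 - real n * (x - a)))" for n x
  show "(\<lambda>x. complex_of_real (g n x)) \<in> closed_span" for n
    unfolding g_def by (rule continuous_in_closed_span[of _ 1]) (auto intro!: continuous_intros)
  show "cmod (complex_of_real (g n x)) \<le> 1" for n x by (simp add: g_def)
  show "(\<lambda>n. complex_of_real (g n x)) \<longlonglongrightarrow> indicator {..a} x" for x
  proof (rule tendsto_eventually)
    show "\<forall>\<^sub>F n in sequentially. complex_of_real (g n x) = indicator {..a} x"
    proof (cases "x \<le> a")
      case True
      then show ?thesis by (simp add: g_def mult_nonneg_nonpos)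
    next
      case False
      obtain N where N: "1 < real N * (x - a)"
        using reals_Archimedean3[of "x - a"] False by auto
      have "g n x = 0" if "n \<ge> N" for n
      proof -
        have "real N * (x - a) \<le> real n * (x - a)" using that False by (intro mult_right_mono) auto
        with N show ?thesis by (simp add: g_def)
      qed
      then show ?thesis using False by (auto simp: eventually_sequentially)
    qed
  qed
qed

text \<open>Half-lines are an intersection-stable generator of the Borel sets. Complements use the
  constant \<open>expo 0\<close>, and disjoint unions are limits of partial sums bounded by
  1.\<close>

lemma indicator_in_closed_span:
  assumes "S \<in> sets M"
  shows "indicator S \<in> closed_span"
proof -
  have "sets borel = sigma_sets UNIV (range (\<lambda>a::real. {..a}))"
    by (simp add: borel_eq_atMost)
  then have S: "S \<in> sigma_sets UNIV (range (\<lambda>a::real. {..a}))"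
    using assms by simp
  have "Int_stable (range (\<lambda>a::real. {..a}))"
    by (auto simp: Int_stable_def intro: range_eqI[of _ _ "min _ _"])
  moreover have "range (\<lambda>a::real. {..a}) \<subseteq> Pow UNIV" by simp
  moreover note S
  ultimately show ?thesis
  proof (induction rule: sigma_sets_induct_disjoint)
    case (basic S)
    then show ?case using halfline_in_closed_span by auto
  next
    case empty
    then show ?case using closed_span_zero by (simp add: indicator_def[abs_def])
  next
    case (compl S)
    have "indicator (UNIV - S) = (\<lambda>x. expo 0 x + (- 1) * (indicator S x :: complex))"
      by (auto simp: indicator_def)
    then show ?case
      using closed_span_add[OF expo_in_closed_span[of 0] closed_span_scale[OF compl(2), of "- 1"]]
      by simp
  next
    case (union S)
    show ?case
    proof (rule closed_span_bounded_limit)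
      have eq: "(\<Sum>i<n. indicator (S i) x) = (indicator (\<Union>i<n. S i) x :: complex)" for n x
        by (rule indicator_UN_disjoint[OF finite_lessThan
              disjoint_family_on_mono[OF subset_UNIV union(1)], symmetric])
      show "(\<lambda>x. \<Sum>i<n. indicator (S i) x) \<in> closed_span" for n
        using union(3) by (intro closed_span_sum) auto
      show "cmod (\<Sum>i<n. indicator (S i) x) \<le> 1" for n x
        unfolding eq by (simp add: indicator_def)
      show "(\<lambda>n. \<Sum>i<n. indicator (S i) x) \<longlonglongrightarrow> (indicator (\<Union>i. S i) x :: complex)" for x
        unfolding eq by (rule LIMSEQ_indicator_UN)
    qed
  qed
qed

lemma closed_span_eq_L2_if_expo: "closed_span = L2 M"
  by (intro closed_span_eq_L2 indicator_in_closed_span)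

end

end

section \<open>Completeness\<close>

lemma finite_words_of_length:
  assumes "digit_system A"
  shows "finite (words_of_length A n)"
proof -
  have "words_of_length A n \<subseteq> digit_word A ` {v. length v = n}"
    using digit_word_surj[OF assms] by (force simp: words_of_length_def)
  moreover have "finite {v :: bool list. length v = n}"
    using finite_lists_length_eq[of "UNIV :: bool set" n] by simp
  ultimately show ?thesis by (meson finite_imageI finite_subset)
qed

lemma sum_words_of_length_Suc:
  assumes A: "digit_system A"
  shows "(\<Sum>w\<in>words_of_length A (Suc n). f w) = (\<Sum>w\<in>words_of_length A n. \<Sum>d\<in>A w. f (w @ [d]))"
proof -
  have fin: "finite (A w)" if "w \<in> words_of_length A n" for w
    using that A unfolding digit_system_def words_of_length_def by force
  have "words_of_length A (Suc n) = (\<lambda>(w, d). w @ [d]) ` Sigma (words_of_length A n) A"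
  proof (intro equalityI subsetI)
    fix w assume w: "w \<in> words_of_length A (Suc n)"
    then show "w \<in> (\<lambda>(w, d). w @ [d]) ` Sigma (words_of_length A n) A"
      by (cases w rule: rev_cases) (auto simp: words_of_length_def)
  qed (auto simp: words_of_length_def)
  moreover have "inj_on (\<lambda>(w, d). w @ [d]) (Sigma (words_of_length A n) A)"
    by (auto simp: inj_on_def)
  ultimately have "(\<Sum>w\<in>words_of_length A (Suc n). f w)
      = (\<Sum>(w, d)\<in>Sigma (words_of_length A n) A. f (w @ [d]))"
    by (simp add: sum.reindex case_prod_unfold)
  also have "\<dots> = (\<Sum>w\<in>words_of_length A n. \<Sum>d\<in>A w. f (w @ [d]))"
    using fin by (intro sum.Sigma[symmetric] finite_words_of_length[OF A]) auto
  finally show ?thesis .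
qed

lemma cos2_shift_cong:
  assumes "2 * 4 ^ k dvd l - l'"
  shows "cos2 ((t - of_int l) / 4 ^ k) = cos2 ((t - of_int l') / 4 ^ k)"
proof -
  obtain z where z: "l - l' = 2 * 4 ^ k * z" using assms by blast
  have "(t - of_int l) / 4 ^ k = (t - of_int l') / 4 ^ k - of_int (l - l') / 4 ^ k"
    by (simp add: diff_divide_distrib[symmetric])
  also have "of_int (l - l') / 4 ^ k = (of_int (2 * z) :: real)"
    unfolding z by simp
  finally have "(t - of_int l) / 4 ^ k = (t - of_int l') / 4 ^ k + of_int (- (2 * z))"
    by simp
  then show ?thesis by (simp only: cos2_add_int) simp
qed

text \<open>Following the digits \<open>w\<close> from \<open>t\<close> as a random walk, where the step with index \<open>k\<close> is taken
  with probability \<open>cos2 ((t - word_sum w) / 4 ^ k)\<close>, \<open>weight t n (word_sum w)\<close> is the probability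
  of the first \<open>n\<close> steps.\<close>

definition weight :: "real \<Rightarrow> nat \<Rightarrow> int \<Rightarrow> real" where
  "weight t n l = (\<Prod>k<n. cos2 ((t - of_int l) / 4 ^ k))"

lemma weight_nonneg: "weight t n l \<ge> 0"
  unfolding weight_def by (intro prod_nonneg ballI cos2_nonneg)

text \<open>A step with index k < n sees l only modulo \<open>2 * 4 ^ k\<close>, since
  \<open>cos2\<close> has period 2. Hence an element of \<open>Lambda_digits A\<close> has the same
  weight as its word of length n.\<close>

lemma weight_cong:
  assumes "[l = l'] (mod 4 ^ n)"
  shows "weight t n l = weight t n l'"
  unfolding weight_def
proof (intro prod.cong refl cos2_shift_cong)
  fix k assume "k \<in> {..<n}"
  then have "(4::int) * 4 ^ k dvd 4 ^ n"
    using le_imp_power_dvd[of "Suc k" n "4 :: int"] by simp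
  moreover have "2 * 4 ^ k dvd 4 * (4::int) ^ k" by (intro mult_dvd_mono) auto
  ultimately show "2 * 4 ^ k dvd l - l'"
    using assms by (meson cong_iff_dvd_diff dvd_trans)
qed

text \<open>Conservation of probability: extending a word by 0 or by the odd digit splits its weight
  into two complementary parts.\<close>

lemma sum_weight_words:
  assumes A: "digit_system A"
  shows "(\<Sum>w\<in>words_of_length A n. weight t n (word_sum w)) = 1"
proof (induction n)
  case 0
  have "words_of_length A 0 = {[]}" by (auto simp: words_of_length_def)
  then show ?case by (simp add: weight_def)
next
  case (Suc n)
  have "(\<Sum>d\<in>A w. weight t (Suc n) (word_sum (w @ [d]))) = weight t n (word_sum w)"
    if w: "w \<in> words_of_length A n" for w
  proof -
    let ?S = "word_sum w"
    have len: "length w = n" and wA: "w \<in> digit_words A" using w by (auto simp: words_of_length_def)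
    obtain a where a: "odd a" "A w = {0, a}" using digit_systemD[OF A wA] .
    have step: "weight t (Suc n) (word_sum (w @ [d])) = weight t n ?S * cos2 ((t - of_int ?S) / 4 ^ n + of_int (- d))"
      for d
    proof -
      have "(t - of_int (?S + d * 4 ^ n)) / 4 ^ n = (t - of_int ?S) / 4 ^ n + of_int (- d)"
        by (simp add: field_simps)
      moreover have "weight t n (?S + d * 4 ^ n) = weight t n ?S"
        by (intro weight_cong) (simp add: cong_def)
      ultimately show ?thesis using len by (simp add: weight_def)
    qed
    have "a \<noteq> 0" using a by auto
    then have "(\<Sum>d\<in>A w. weight t (Suc n) (word_sum (w @ [d])))
        = weight t n ?S * (cos2 ((t - of_int ?S) / 4 ^ n + of_int (- 0)) + cos2 ((t - of_int ?S) / 4 ^ n + of_int (- a)))"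
      unfolding a(2) step by (simp add: ring_distribs)
    also have "\<dots> = weight t n ?S"
      using a(1) unfolding cos2_add_int by simp
    finally show ?thesis .
  qed
  then show ?case by (simp add: sum_words_of_length_Suc[OF A] Suc)
qed

text \<open>A geometric series with ratio 4. After rescaling by \<open>4 ^ length w\<close> it
  bounds the positions of the walk.\<close>

lemma abs_word_sum_le:
  assumes "\<And>w d. w \<in> digit_words A \<Longrightarrow> d \<in> A w \<Longrightarrow> \<bar>d\<bar> \<le> C" and "w \<in> digit_words A"
  shows "3 * \<bar>word_sum w\<bar> \<le> C * (4 ^ length w - 1)"
  using assms(2)
proof (induction w rule: rev_induct)
  case (snoc d w)
  then have IH: "3 * \<bar>word_sum w\<bar> \<le> C * (4 ^ length w - 1)" and "\<bar>d\<bar> \<le> C"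
    using assms(1) by auto
  then have "\<bar>d * 4 ^ length w\<bar> \<le> C * 4 ^ length w"
    by (simp add: abs_mult)
  with IH show ?case
    using abs_triangle_ineq[of "word_sum w" "d * 4 ^ length w"] by (simp add: algebra_simps)
qed simp

context mu4
begin

lemma ft2_eq_weight: "ft2 (t - of_int l) = weight t n l * ft2 ((t - of_int l) / 4 ^ n)"
  unfolding weight_def by (rule ft2_iterate)

lemma weight_tendsto_ft2: "(\<lambda>n. weight t n l) \<longlonglongrightarrow> ft2 (t - of_int l)"
proof -
  let ?h = "\<lambda>n. ft2 ((t - of_int l) / 4 ^ n)"
  have "(\<lambda>n. ft2 (t - of_int l) / ?h n) \<longlonglongrightarrow> ft2 (t - of_int l) / 1"
    by (intro tendsto_divide tendsto_const ft2_tendsto_1) simp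
  moreover have "\<forall>\<^sub>F n in sequentially. ft2 (t - of_int l) / ?h n = weight t n l"
    using order_tendstoD(1)[OF ft2_tendsto_1[of "t - of_int l"], of 0]
  proof (rule eventually_mono)
    fix n assume "0 < ?h n"
    then show "ft2 (t - of_int l) / ?h n = weight t n l"
      using ft2_eq_weight[of t l n] by simp
  qed simp
  ultimately show ?thesis using Lim_transform_eventually by fastforce
qed

text \<open>The cosine condition expresses distance at least 1/4 from the integers and is closed, so
  K is compact. K contains no nonzero integer, hence \<open>ft2\<close> is positive on K and attains
  a positive minimum.\<close>

lemma ft2_uniform_lower_bound:
  obtains \<delta> where "\<delta> > 0" "\<delta> \<le> 1" "\<And>y. \<bar>y\<bar> \<le> 1 / 4 \<Longrightarrow> \<delta> \<le> ft2 y"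
    "\<And>y. \<bar>y\<bar> \<le> R \<Longrightarrow> cos (2 * pi * y) \<le> 0 \<Longrightarrow> \<delta> \<le> ft2 y"
proof -
  define K where "K = cball 0 (1 / 4) \<union> (cball 0 R \<inter> {y. cos (2 * pi * y) \<le> 0})"
  have "closed {y :: real. cos (2 * pi * y) \<le> 0}"
    by (intro closed_Collect_le continuous_intros)
  then have "compact K" unfolding K_def by (intro compact_Un compact_Int_closed compact_cball)
  moreover have "K \<noteq> {}" by (auto simp: K_def)
  ultimately obtain z where z: "z \<in> K" "\<And>y. y \<in> K \<Longrightarrow> ft2 z \<le> ft2 y"
    using continuous_attains_inf[OF _ _ continuous_on_ft2, of K] by blast
  have "z = 0 \<or> z \<notin> \<int>"
  proof (rule ccontr)
    assume "\<not> (z = 0 \<or> z \<notin> \<int>)"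
    then obtain m where m: "z = of_int m" "m \<noteq> 0" by (auto elim!: Ints_cases)
    then have "\<bar>z\<bar> \<ge> 1" by linarith
    moreover have "cos (2 * pi * z) = 1" using m by simp
    ultimately show False using z(1) by (auto simp: K_def)
  qed
  then have "ft2 z > 0" using ft2_pos by blast
  then show ?thesis
    using z(2) ft2_le_1[of z] by (intro that[of "ft2 z"]) (auto simp: K_def)
qed

text \<open>From a point \<open>x = (t - word_sum w) / 4 ^ n\<close> at distance at least $1/4$ from the integers it
  suffices to continue with zeros. Otherwise one follows the expansion of the nearest integer. If it
  never leaves the tree, that integer gives the required element; if it does, the walk arrives
  close to an odd multiple of $1/2$, from where one continues with zeros.\<close>

lemma exists_heavy_continuation:
  assumes A: "digit_system A" and C: "\<And>w d. w \<in> digit_words A \<Longrightarrow> d \<in> A w \<Longrightarrow> \<bar>d\<bar> \<le> C"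
    and R: "\<bar>t\<bar> \<le> R" "of_int C \<le> 3 * R"
    and \<delta>: "\<delta> > 0" "\<delta> \<le> 1" "\<And>y. \<bar>y\<bar> \<le> 1 / 4 \<Longrightarrow> \<delta> \<le> ft2 y"
      "\<And>y. \<bar>y\<bar> \<le> R \<Longrightarrow> cos (2 * pi * y) \<le> 0 \<Longrightarrow> \<delta> \<le> ft2 y"
    and w: "w \<in> words_of_length A n"
  shows "\<exists>l\<in>Lambda_digits A. [l = word_sum w] (mod 4 ^ n) \<and> \<delta>\<^sup>2 \<le> ft2 ((t - of_int l) / 4 ^ n)"
proof -
  have \<delta>2: "\<delta>\<^sup>2 \<le> \<delta>" using \<delta> by (simp add: power2_eq_square mult_left_le)
  have cos_nonneg: "0 \<le> cos (2 * pi * y)" if "\<bar>y\<bar> \<le> 1 / 4" for y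
  proof -
    have "2 * pi * \<bar>y\<bar> \<le> 2 * pi * (1 / 4)" using that by (intro mult_left_mono) auto
    moreover have "0 \<le> 2 * pi * \<bar>y\<bar>" by simp
    ultimately have "0 \<le> cos (2 * pi * \<bar>y\<bar>)"
      using pi_gt_zero by (intro cos_ge_zero) linarith+
    then show ?thesis by (simp add: abs_if split: if_splits)
  qed
  have in_R: "\<bar>(t - of_int (word_sum u)) / 4 ^ length u\<bar> \<le> R" if "u \<in> digit_words A" for u
  proof -
    have "3 * \<bar>word_sum u\<bar> \<le> C * (4 ^ length u - 1)" using abs_word_sum_le[OF C that] by simp
    then have "real_of_int (3 * \<bar>word_sum u\<bar>) \<le> real_of_int (C * (4 ^ length u - 1))"
      by (rule of_int_le_iff[THEN iffD2])
    then have "3 * \<bar>of_int (word_sum u)\<bar> \<le> of_int C * (4 ^ length u - 1 :: real)" by simp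
    also have "\<dots> \<le> 3 * R * (4 ^ length u - 1)"
      using R by (intro mult_right_mono) auto
    finally have "\<bar>of_int (word_sum u)\<bar> \<le> R * (4 ^ length u - 1)" by simp
    with R have "\<bar>t - of_int (word_sum u)\<bar> \<le> R * 4 ^ length u"
      by (simp add: algebra_simps)
    then show ?thesis by (simp add: abs_divide field_simps)
  qed
  have len: "length w = n" and wA: "w \<in> digit_words A" using w by (auto simp: words_of_length_def)
  define x where "x = (t - of_int (word_sum w)) / 4 ^ n"
  show ?thesis
  proof (cases "cos (2 * pi * x) \<le> 0")
    case True
    have "\<delta> \<le> ft2 x" using \<delta>(4) True in_R[OF wA] by (simp add: x_def len)
    then show ?thesis
      using word_sum_in_Lambda_digits[OF A wA] \<delta>2 by (intro bexI[of _ "word_sum w"]) (auto simp: x_def)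
  next
    case False
    define m where "m = round x"
    define \<theta> where "\<theta> = x - of_int m"
    have \<theta>: "\<bar>\<theta>\<bar> \<le> 1 / 4"
    proof (rule ccontr)
      assume far: "\<not> \<bar>\<theta>\<bar> \<le> 1 / 4"
      have "\<bar>\<theta>\<bar> \<le> 1 / 2"
        using of_int_round_abs_le[of x] by (simp add: \<theta>_def m_def abs_minus_commute)
      then have "cos (2 * pi * \<bar>\<theta>\<bar>) \<le> cos (pi / 2)"
        using far pi_gt_zero by (intro cos_monotone_0_pi_le) (auto simp: field_simps)
      moreover have "cos (2 * pi * \<bar>\<theta>\<bar>) = cos (2 * pi * \<theta>)" by (simp add: abs_if)
      moreover have "cos (2 * pi * \<theta>) = cos (2 * pi * x)"
        by (simp add: \<theta>_def right_diff_distrib cos_diff)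
      ultimately show False using False by simp
    qed
    define l0 where "l0 = word_sum w + 4 ^ n * m"
    have l0: "(t - of_int l0) / 4 ^ n = \<theta>"
      by (simp add: l0_def \<theta>_def x_def field_simps)
    have l0_cong: "[l0 = word_sum w] (mod 4 ^ n)" by (simp add: l0_def cong_def)
    show ?thesis
    proof (cases "l0 \<in> Lambda_digits A")
      case True
      then show ?thesis using l0 l0_cong \<delta>(3)[OF \<theta>] \<delta>2 by (intro bexI[of _ l0]) auto
    next
      case False
      let ?P = "\<lambda>N. \<exists>u\<in>words_of_length A N. [word_sum u = l0] (mod 4 ^ N)"
      \<comment> \<open>The first length at which l0 leaves the tree. It exceeds n, because the
        prefixes of w agree with l0 up to length n.\<close>
      obtain N0 where N0: "\<not> ?P N0" "\<forall>N<N0. ?P N"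
        using False exists_least_iff[of "\<lambda>N. \<not> ?P N"] unfolding Lambda_digits_iff[OF A] by blast
      have P_le: "?P N" if "N \<le> n" for N
      proof
        show "take N w \<in> words_of_length A N"
          using that len wA by (simp add: words_of_length_def take_in_digit_words)
        have "[word_sum (take N w) = word_sum w] (mod 4 ^ N)"
          using that len by (intro word_sum_take_cong) simp
        also have "[word_sum w = l0] (mod 4 ^ N)"
          using cong_power_le[OF cong_sym[OF l0_cong] that] .
        finally show "[word_sum (take N w) = l0] (mod 4 ^ N)" .
      qed
      have "n < N0" using N0(1) P_le[of N0] not_le by metis
      then obtain N where Suc_N: "N0 = Suc N" by (cases N0) simp_all
      have N: "n \<le> N" "?P N" "\<not> ?P (Suc N)"
      proof -
        show "n \<le> N" using \<open>n < N0\<close> Suc_N by simp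
        show "?P N" by (rule N0(2)[rule_format]) (simp add: Suc_N)
        show "\<not> ?P (Suc N)" using N0(1) unfolding Suc_N .
      qed
      obtain u where u: "u \<in> words_of_length A N" "[word_sum u = l0] (mod 4 ^ N)"
        using N(2) by (rule bexE)
      have len_u: "length u = N" and uA: "u \<in> digit_words A" using u by (auto simp: words_of_length_def)
      obtain r where r: "l0 - word_sum u = 4 ^ N * r"
        using cong_sym[OF u(2)] by (auto simp: cong_iff_dvd_diff)
      obtain a where a: "odd a" "A u = {0, a}" using digit_systemD[OF A uA] .
      \<comment> \<open>Parity can always be matched, as the digit set is {0, a} with a odd. No
        digit matches r modulo 4, so the mismatch r - d is 2 modulo 4 and q will be odd.\<close>
      obtain d where d: "d \<in> A u" "even (r - d)"
        using a by (cases "even r") auto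
      obtain q where q: "r - d = 2 * q" using d(2) by blast
      define l where "l = word_sum (u @ [d])"
      have udA: "u @ [d] \<in> digit_words A" using uA d by simp
      have diff: "l0 - l = 4 ^ N * (2 * q)"
        using r q by (simp add: l_def len_u algebra_simps)
      have "odd q"
      proof
        assume "even q"
        then have "4 ^ Suc N dvd l0 - l" unfolding diff by auto
        then have "[word_sum (u @ [d]) = l0] (mod 4 ^ Suc N)"
          by (metis cong_iff_dvd_diff cong_sym l_def)
        moreover have "u @ [d] \<in> words_of_length A (Suc N)"
          using udA len_u by (simp add: words_of_length_def)
        ultimately show False using N(3) by blast
      qed
      \<comment> \<open>The number of steps from level n to level N + 1, just after the digit
        d.\<close>
      define p where "p = Suc (N - n)"
      have pN: "Suc N = n + p" using N(1) by (simp add: p_def)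
      have 1: "(t - of_int l) / 4 ^ n = \<theta> - of_int (- (4 ^ (N - n) * (2 * q)))"
      proof -
        have "of_int l0 - of_int l = (4 ^ n * (4 ^ (N - n) * (2 * of_int q)) :: real)"
          unfolding of_int_diff[symmetric] diff using N(1) by (simp flip: power_add)
        then have "(t - of_int l) / 4 ^ n = (t - of_int l0) / 4 ^ n + 4 ^ (N - n) * (2 * of_int q)"
          by (simp add: field_simps)
        then show ?thesis by (simp add: l0)
      qed
      \<comment> \<open>In these steps l and l0 are indistinguishable: they differ by a multiple of
        \<open>2 * 4 ^ N\<close>, and \<open>cos2\<close> has period 2.\<close>
      have "(\<Prod>k<p. cos2 ((t - of_int l) / 4 ^ n / 4 ^ k)) = (\<Prod>k<p. cos2 (\<theta> / 4 ^ k))"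
      proof (intro prod.cong refl)
        fix k assume "k \<in> {..<p}"
        then have "(4::int) ^ k dvd 4 ^ (N - n)" by (intro le_imp_power_dvd) (simp add: p_def)
        then have "4 ^ k * 2 dvd 4 ^ (N - n) * (2 * q)" by (intro mult_dvd_mono) auto
        then have "2 * 4 ^ k dvd - (4 ^ (N - n) * (2 * q)) - 0"
          by (simp only: diff_0_right dvd_minus_iff mult.commute[of "2 :: int" "4 ^ k"])
        from cos2_shift_cong[OF this, of \<theta>]
        show "cos2 ((t - of_int l) / 4 ^ n / 4 ^ k) = cos2 (\<theta> / 4 ^ k)"
          unfolding 1 by simp
      qed
      moreover have "\<delta> \<le> (\<Prod>k<p. cos2 (\<theta> / 4 ^ k))"
      proof -
        have "(\<Prod>k<p. cos2 (\<theta> / 4 ^ k)) * ft2 (\<theta> / 4 ^ p) \<le> (\<Prod>k<p. cos2 (\<theta> / 4 ^ k))"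
          by (intro mult_left_le ft2_le_1 prod_nonneg cos2_nonneg)
        then show ?thesis using \<delta>(3)[OF \<theta>] ft2_iterate[of \<theta> p] by simp
      qed
      moreover have "\<delta> \<le> ft2 ((t - of_int l) / 4 ^ n / 4 ^ p)"
      proof (rule \<delta>(4))
        have eq: "(t - of_int l) / 4 ^ n / 4 ^ p = (t - of_int l) / 4 ^ Suc N"
          unfolding pN power_add by simp
        show "\<bar>(t - of_int l) / 4 ^ n / 4 ^ p\<bar> \<le> R"
          unfolding eq using in_R[OF udA] by (simp add: l_def len_u)
        \<comment> \<open>The offset 2 * q at level N becomes q / 2 one level later, which for odd q
          reverses the sign of the cosine.\<close>
        have "(t - of_int l) / 4 ^ n / 4 ^ p = \<theta> / 4 ^ p + of_int q / 2"
          unfolding 1 by (simp add: p_def field_simps)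
        then have "2 * pi * ((t - of_int l) / 4 ^ n / 4 ^ p) = 2 * pi * (\<theta> / 4 ^ p) + pi * of_int q"
          by (simp add: algebra_simps)
        then have "cos (2 * pi * ((t - of_int l) / 4 ^ n / 4 ^ p))
            = cos (2 * pi * (\<theta> / 4 ^ p) + pi * of_int q)" by (rule arg_cong)
        also have "\<dots> = - cos (2 * pi * (\<theta> / 4 ^ p))"
        proof -
          have "sin (pi * of_int q) = 0" by (simp add: mult.commute)
          then show ?thesis using cos_pi_int[of q] \<open>odd q\<close> by (simp add: cos_add)
        qed
        also have "\<dots> \<le> 0"
        proof -
          have "\<bar>\<theta> / 4 ^ p\<bar> \<le> \<bar>\<theta>\<bar> / 1"
            unfolding abs_divide by (intro divide_left_mono) auto
          from order_trans[OF this[unfolded div_by_1] \<theta>] have "\<bar>\<theta> / 4 ^ p\<bar> \<le> 1 / 4" .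
          from cos_nonneg[OF this] show ?thesis by simp
        qed
        finally show "cos (2 * pi * ((t - of_int l) / 4 ^ n / 4 ^ p)) \<le> 0" .
      qed
      \<comment> \<open>One factor \<delta> accounts for the p steps shared with l0, the other for
        the zeros that follow.\<close>
      ultimately have "\<delta>\<^sup>2 \<le> ft2 ((t - of_int l) / 4 ^ n)"
        using \<delta>(1) unfolding ft2_iterate[of "(t - of_int l) / 4 ^ n" p] power2_eq_square
        by (intro mult_mono) auto
      moreover have "[l = word_sum w] (mod 4 ^ n)"
      proof -
        have "4 ^ n dvd l0 - l" unfolding diff using N(1) by (auto intro: dvd_mult2 le_imp_power_dvd)
        then have "[l = l0] (mod 4 ^ n)" by (metis cong_iff_dvd_diff cong_sym)
        with l0_cong show ?thesis by (rule cong_trans[rotated])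
      qed
      ultimately show ?thesis
        using word_sum_in_Lambda_digits[OF A udA] by (auto simp: l_def)
    qed
  qed
qed

text \<open>The coefficients \<open>ft (t - l)\<close> are the inner products of
  \<open>expo t\<close> with \<open>expo l\<close>, so this is Pythagoras for the orthogonal
  projection onto the span over F.\<close>

lemma norm_expo_diff_projection:
  assumes F: "finite F" and orth: "\<And>l l'. l \<in> F \<Longrightarrow> l' \<in> F \<Longrightarrow> l \<noteq> l' \<Longrightarrow> ft (l - l') = 0"
  shows "(\<integral>x. (cmod (expo t x - (\<Sum>l\<in>F. ft (t - l) * expo l x)))\<^sup>2 \<partial>M) = 1 - (\<Sum>l\<in>F. ft2 (t - l))"
proof -
  let ?c = "\<lambda>l. ft (t - l)"
  have ft_0: "ft 0 = 1" using char_zero by (simp add: ft_eq_char)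
  have cnj_ft: "cnj (ft s) = ft (- s)" for s
    unfolding ft_def by (simp add: expo_minus[abs_def])
  have cc: "?c l * cnj (?c l) = complex_of_real (ft2 (t - l))" for l
    by (simp only: ft2_def complex_norm_square)
  have expand: "complex_of_real ((cmod (expo t x - (\<Sum>l\<in>F. ?c l * expo l x)))\<^sup>2) =
      expo 0 x - (\<Sum>l\<in>F. ?c l * expo (l - t) x) - (\<Sum>l\<in>F. cnj (?c l) * expo (t - l) x)
      + (\<Sum>l\<in>F. \<Sum>l'\<in>F. ?c l * cnj (?c l') * expo (l - l') x)" for x
  proof -
    have e: "expo s x * cnj (expo s' x) = expo (s - s') x" for s s'
      by (simp add: expo_minus[symmetric] expo_add[symmetric])
    have "complex_of_real ((cmod (expo t x - (\<Sum>l\<in>F. ?c l * expo l x)))\<^sup>2) =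
        (expo t x - (\<Sum>l\<in>F. ?c l * expo l x)) * (cnj (expo t x) - (\<Sum>l\<in>F. cnj (?c l) * cnj (expo l x)))"
      unfolding complex_norm_square by simp
    also have "\<dots> = expo t x * cnj (expo t x) - (\<Sum>l\<in>F. ?c l * expo l x) * cnj (expo t x)
        - expo t x * (\<Sum>l\<in>F. cnj (?c l) * cnj (expo l x))
        + (\<Sum>l\<in>F. ?c l * expo l x) * (\<Sum>l\<in>F. cnj (?c l) * cnj (expo l x))"
      by (simp add: algebra_simps)
    also have "(\<Sum>l\<in>F. ?c l * expo l x) * cnj (expo t x) = (\<Sum>l\<in>F. ?c l * (expo l x * cnj (expo t x)))"
      by (simp add: sum_distrib_right mult.assoc)
    also have "expo t x * (\<Sum>l\<in>F. cnj (?c l) * cnj (expo l x))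
        = (\<Sum>l\<in>F. cnj (?c l) * (expo t x * cnj (expo l x)))"
      by (simp add: sum_distrib_left mult_ac)
    also have "(\<Sum>l\<in>F. ?c l * expo l x) * (\<Sum>l\<in>F. cnj (?c l) * cnj (expo l x))
        = (\<Sum>l\<in>F. \<Sum>l'\<in>F. ?c l * cnj (?c l') * (expo l x * cnj (expo l' x)))"
      unfolding sum_product by (simp add: mult_ac)
    finally show ?thesis unfolding e by simp
  qed
  have int: "integrable M (\<lambda>x. a * expo s x)" for a s
    using integrable_expo by simp
  have "(\<integral>x. a * expo s x \<partial>M) = a * ft s" for a s
    by (simp add: ft_def)
  note integral = this
  have "complex_of_real (\<integral>x. (cmod (expo t x - (\<Sum>l\<in>F. ?c l * expo l x)))\<^sup>2 \<partial>M)
      = (\<integral>x. complex_of_real ((cmod (expo t x - (\<Sum>l\<in>F. ?c l * expo l x)))\<^sup>2) \<partial>M)"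
    by (rule integral_complex_of_real[symmetric])
  also have "\<dots> = ft 0 - (\<Sum>l\<in>F. ?c l * ft (l - t)) - (\<Sum>l\<in>F. cnj (?c l) * ft (t - l))
      + (\<Sum>l\<in>F. \<Sum>l'\<in>F. ?c l * cnj (?c l') * ft (l - l'))"
    unfolding expand using integrable_expo
    by (simp add: int integral ft_def[symmetric] del: integral_mult_right_zero expo_0)
  also have "(\<Sum>l\<in>F. \<Sum>l'\<in>F. ?c l * cnj (?c l') * ft (l - l')) = (\<Sum>l\<in>F. ?c l * cnj (?c l))"
  proof (intro sum.cong refl)
    fix l assume l: "l \<in> F"
    have "(\<Sum>l'\<in>F. ?c l * cnj (?c l') * ft (l - l')) = (\<Sum>l'\<in>F. if l' = l then ?c l * cnj (?c l) else 0)"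
      using orth[OF l] by (intro sum.cong) (auto simp: ft_0)
    also have "\<dots> = ?c l * cnj (?c l)" using F l by simp
    finally show "(\<Sum>l'\<in>F. ?c l * cnj (?c l') * ft (l - l')) = ?c l * cnj (?c l)" .
  qed
  also have "(\<Sum>l\<in>F. ?c l * ft (l - t)) = (\<Sum>l\<in>F. ?c l * cnj (?c l))"
    by (simp add: cnj_ft)
  also have "(\<Sum>l\<in>F. cnj (?c l) * ft (t - l)) = (\<Sum>l\<in>F. ?c l * cnj (?c l))"
    by (simp add: mult.commute)
  also note ft_0
  finally have "complex_of_real (\<integral>x. (cmod (expo t x - (\<Sum>l\<in>F. ?c l * expo l x)))\<^sup>2 \<partial>M)
      = complex_of_real (1 - (\<Sum>l\<in>F. ft2 (t - l)))"
    unfolding cc by simp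
  then show ?thesis unfolding of_real_eq_iff .
qed

section \<open>Bessel's inequality for a digit system, and equality under bounded digits\<close>

context
  fixes A :: "int list \<Rightarrow> int set"
  assumes A: "digit_system A"
begin

lemma norm_expo_diff_Lambda_projection:
  assumes F: "finite F" "F \<subseteq> Lambda_digits A"
  shows "(\<integral>x. (cmod (expo t x - (\<Sum>l\<in>real_of_int ` F. ft (t - l) * expo l x)))\<^sup>2 \<partial>M)
    = 1 - (\<Sum>l\<in>F. ft2 (t - of_int l))"
proof -
  have "ft (s - s') = 0" if s: "s \<in> real_of_int ` F" "s' \<in> real_of_int ` F" "s \<noteq> s'" for s s'
    using orthogonal_Lambda_digits[OF A] F(2) s
    unfolding orthogonal_family_def L2_inner_expo by blast
  then have "(\<integral>x. (cmod (expo t x - (\<Sum>l\<in>real_of_int ` F. ft (t - l) * expo l x)))\<^sup>2 \<partial>M)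
      = 1 - (\<Sum>l\<in>real_of_int ` F. ft2 (t - l))"
    using F(1) by (intro norm_expo_diff_projection) auto
  also have "(\<Sum>l\<in>real_of_int ` F. ft2 (t - l)) = (\<Sum>l\<in>F. ft2 (t - of_int l))"
    by (subst sum.reindex) (auto simp: inj_on_def)
  finally show ?thesis .
qed

lemma sum_ft2_Lambda_le_1:
  assumes F: "finite F" "F \<subseteq> Lambda_digits A"
  shows "(\<Sum>l\<in>F. ft2 (t - of_int l)) \<le> 1"
proof -
  have "0 \<le> (\<integral>x. (cmod (expo t x - (\<Sum>l\<in>real_of_int ` F. ft (t - l) * expo l x)))\<^sup>2 \<partial>M)"
    by (intro Bochner_Integration.integral_nonneg) simp
  then show ?thesis unfolding norm_expo_diff_Lambda_projection[OF F] by simp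
qed

text \<open>If the supremum \<open>a\<close> of the sums were less than 1, a sum close to \<open>a\<close> would leave a positive
  proportion of the words of length \<open>n\<close> uncovered, and the heavy continuations of the latter would
  push the sum above \<open>a\<close>.\<close>

lemma sum_ft2_Lambda_arbitrarily_close:
  assumes "uniformly_bounded A" and "\<epsilon> > 0"
  obtains F where "finite F" "F \<subseteq> Lambda_digits A" "(\<Sum>l\<in>F. ft2 (t - of_int l)) > 1 - \<epsilon>"
proof -
  obtain C where C: "\<And>w d. w \<in> digit_words A \<Longrightarrow> d \<in> A w \<Longrightarrow> \<bar>d\<bar> \<le> C"
    using assms by (auto simp: uniformly_bounded_def)
  \<comment> \<open>The interval from -R to R is invariant under x -> (x - d) / 4: from
    \<bar>d\<bar> \<le> C \<le> 3 * R follows (R + 3 * R) / 4 = R as a bound.\<close>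
  define R where "R = max \<bar>t\<bar> (of_int C)"
  obtain a0 where "odd a0" "A [] = {0, a0}" using digit_systemD[OF A Nil_in_digit_words] .
  then have "0 \<le> C" using C[of "[]" 0] by simp
  then have R: "\<bar>t\<bar> \<le> R" "of_int C \<le> 3 * R" by (auto simp: R_def)
  obtain \<delta>0 where \<delta>0: "\<delta>0 > 0" "\<delta>0 \<le> 1" "\<And>y. \<bar>y\<bar> \<le> 1 / 4 \<Longrightarrow> \<delta>0 \<le> ft2 y"
    "\<And>y. \<bar>y\<bar> \<le> R \<Longrightarrow> cos (2 * pi * y) \<le> 0 \<Longrightarrow> \<delta>0 \<le> ft2 y"
    by (rule ft2_uniform_lower_bound[of R]) blast
  define \<delta> where "\<delta> = \<delta>0\<^sup>2"
  have \<delta>: "\<delta> > 0" using \<delta>0 by (simp add: \<delta>_def)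
  define s where "s F = (\<Sum>l\<in>F. ft2 (t - real_of_int l))" for F
  define \<F> where "\<F> = {F. finite F \<and> F \<subseteq> Lambda_digits A}"
  define a where "a = (SUP F\<in>\<F>. s F)"
  have bdd: "bdd_above (s ` \<F>)"
    using sum_ft2_Lambda_le_1 by (intro bdd_aboveI2[of _ _ 1]) (auto simp: \<F>_def s_def)
  have s_le: "s F \<le> a" if "F \<in> \<F>" for F
    unfolding a_def using that bdd by (rule cSUP_upper)
  have ne: "s ` \<F> \<noteq> {}" by (auto simp: \<F>_def)
  have near: "\<exists>F\<in>\<F>. s F > a - \<eta>" if "\<eta> > 0" for \<eta>
    using less_cSup_iff[OF ne bdd, of "a - \<eta>"] that by (auto simp: a_def)
  have "a \<ge> 1"
  proof (rule ccontr)
    assume "\<not> a \<ge> 1"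
    \<comment> \<open>Half of the value at which the gain \<delta> * (1 - a - \<eta>) from the
      uncovered words would just balance the loss \<eta>.\<close>
    define \<eta> where "\<eta> = \<delta> * (1 - a) / (2 * (1 + \<delta>))"
    have \<eta>: "\<eta> > 0" using \<delta> \<open>\<not> a \<ge> 1\<close> by (simp add: \<eta>_def)
    have "\<eta> * (1 + \<delta>) = \<delta> * (1 - a) / 2" using \<delta> by (simp add: \<eta>_def field_simps)
    moreover have "\<delta> * (1 - a) > 0" using \<delta> \<open>\<not> a \<ge> 1\<close> by simp
    ultimately have \<eta>_small: "\<eta> * (1 + \<delta>) < \<delta> * (1 - a)" by linarith
    obtain F where F: "F \<in> \<F>" "s F > a - \<eta>" using near[OF \<eta>] by blast
    then have finF: "finite F" and F\<Lambda>: "F \<subseteq> Lambda_digits A" by (auto simp: \<F>_def)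
    \<comment> \<open>Weights decrease to \<open>ft2\<close>, so for suitable n the words used by F
      carry total weight less than s F + \<eta>.\<close>
    have "(\<lambda>n. \<Sum>l\<in>F. weight t n l) \<longlonglongrightarrow> s F"
      unfolding s_def by (intro tendsto_sum weight_tendsto_ft2)
    from order_tendstoD(2)[OF this, of "s F + \<eta>"] obtain n where n: "(\<Sum>l\<in>F. weight t n l) < s F + \<eta>"
      using \<eta> by (auto simp: eventually_sequentially)
    define W where "W = words_of_length A n"
    have finW: "finite W" unfolding W_def by (rule finite_words_of_length[OF A])
    have "\<forall>l\<in>F. \<exists>u. u \<in> W \<and> [word_sum u = l] (mod 4 ^ n)"
    proof
      fix l assume "l \<in> F"
      then have "l \<in> Lambda_digits A" using F\<Lambda> by blast
      then show "\<exists>u. u \<in> W \<and> [word_sum u = l] (mod 4 ^ n)"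
        unfolding Lambda_digits_iff[OF A] W_def by blast
    qed
    from bchoice[OF this] obtain \<pi> where
      "\<forall>l\<in>F. \<pi> l \<in> W \<and> [word_sum (\<pi> l) = l] (mod 4 ^ n)" ..
    then have \<pi>: "\<pi> l \<in> W" "[word_sum (\<pi> l) = l] (mod 4 ^ n)" if "l \<in> F" for l
      using that by auto
    have "\<forall>w\<in>W. \<exists>l. l \<in> Lambda_digits A \<and> [l = word_sum w] (mod 4 ^ n) \<and>
        \<delta> \<le> ft2 ((t - of_int l) / 4 ^ n)"
    proof
      fix w assume "w \<in> W"
      then have w: "w \<in> words_of_length A n" by (simp add: W_def)
      have "\<exists>l\<in>Lambda_digits A. [l = word_sum w] (mod 4 ^ n) \<and>
          \<delta>0\<^sup>2 \<le> ft2 ((t - of_int l) / 4 ^ n)"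
        by (intro exists_heavy_continuation[OF A _ R \<delta>0(1,2)]) (fact C \<delta>0(3,4) w)+
      then show "\<exists>l. l \<in> Lambda_digits A \<and> [l = word_sum w] (mod 4 ^ n) \<and>
        \<delta> \<le> ft2 ((t - of_int l) / 4 ^ n)"
        unfolding \<delta>_def by blast
    qed
    from bchoice[OF this] obtain g where
      "\<forall>w\<in>W. g w \<in> Lambda_digits A \<and> [g w = word_sum w] (mod 4 ^ n) \<and>
        \<delta> \<le> ft2 ((t - of_int (g w)) / 4 ^ n)" ..
    then have g: "g w \<in> Lambda_digits A" "[g w = word_sum w] (mod 4 ^ n)"
        "\<delta> \<le> ft2 ((t - of_int (g w)) / 4 ^ n)" if "w \<in> W" for w
      using that by auto
    have g_unique: "u = w" if "u \<in> W" "w \<in> W" "[word_sum u = g w] (mod 4 ^ n)" for u w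
      using digit_word_unique[OF A that(1,2)[unfolded W_def] cong_trans[OF that(3) g(2)[OF that(2)]]] .
    define V where "V = W - \<pi> ` F"
    have VW: "V \<subseteq> W" by (auto simp: V_def)
    have inj: "inj_on g V"
    proof (rule inj_onI)
      fix u v assume uv: "u \<in> V" "v \<in> V" "g u = g v"
      then have "[word_sum u = g v] (mod 4 ^ n)" using cong_sym[OF g(2)[of u]] VW by auto
      then show "u = v" using uv VW by (intro g_unique) auto
    qed
    have disj: "F \<inter> g ` V = {}"
    proof (rule ccontr)
      assume "F \<inter> g ` V \<noteq> {}"
      then obtain w where w: "w \<in> V" "g w \<in> F" by blast
      then have "\<pi> (g w) = w" using \<pi>[OF w(2)] VW by (intro g_unique) auto
      then have "w \<in> \<pi> ` F" using w(2) by (metis imageI)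
      then show False using w(1) by (simp add: V_def)
    qed
    have "1 = (\<Sum>w\<in>W. weight t n (word_sum w))"
      unfolding W_def by (simp add: sum_weight_words[OF A])
    also have "\<dots> = (\<Sum>w\<in>V. weight t n (word_sum w)) + (\<Sum>w\<in>\<pi> ` F. weight t n (word_sum w))"
      unfolding V_def using \<pi>(1) by (intro sum.subset_diff finW) auto
    \<comment> \<open>Only an inequality, since several elements of F may share their word of length
      n.\<close>
    also have "(\<Sum>w\<in>\<pi> ` F. weight t n (word_sum w)) \<le> (\<Sum>l\<in>F. weight t n (word_sum (\<pi> l)))"
      using sum_image_le[OF finF, of "\<lambda>w. weight t n (word_sum w)" \<pi>] weight_nonneg
      by (simp add: o_def)
    also have "\<dots> = (\<Sum>l\<in>F. weight t n l)"
      using \<pi>(2) by (intro sum.cong refl weight_cong)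
    finally have V: "(\<Sum>w\<in>V. weight t n (word_sum w)) > 1 - a - \<eta>"
      using n s_le[OF F(1)] by simp
    have "\<delta> * (1 - a - \<eta>) \<le> \<delta> * (\<Sum>w\<in>V. weight t n (word_sum w))"
      using V \<delta> by (intro mult_left_mono) auto
    also have "\<dots> = (\<Sum>w\<in>V. weight t n (word_sum w) * \<delta>)"
      by (simp add: sum_distrib_left mult.commute)
    also have "\<dots> \<le> (\<Sum>w\<in>V. ft2 (t - of_int (g w)))"
    proof (rule sum_mono)
      fix w assume "w \<in> V"
      then have w: "w \<in> W" by (simp add: V_def)
      have "weight t n (word_sum w) = weight t n (g w)"
        using cong_sym[OF g(2)[OF w]] by (rule weight_cong)
      then show "weight t n (word_sum w) * \<delta> \<le> ft2 (t - of_int (g w))"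
        unfolding ft2_eq_weight[of t "g w" n] using g(3)[OF w] weight_nonneg
        by (auto intro: mult_left_mono)
    qed
    also have "\<dots> = s (g ` V)" unfolding s_def by (simp add: sum.reindex[OF inj])
    finally have "s F + s (g ` V) > a - \<eta> + \<delta> * (1 - a - \<eta>)" using F(2) by simp
    moreover have "s F + s (g ` V) = s (F \<union> g ` V)"
      unfolding s_def using disj finF finW by (intro sum.union_disjoint[symmetric]) (auto simp: V_def)
    moreover have "s (F \<union> g ` V) \<le> a"
      using finF finite_subset[OF VW finW] F\<Lambda> g(1) VW by (intro s_le) (auto simp: \<F>_def)
    ultimately show False using \<eta>_small by (simp add: algebra_simps)
  qed
  then obtain F where "F \<in> \<F>" "s F > 1 - \<epsilon>" using near[OF \<open>\<epsilon> > 0\<close>] by force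
  then show ?thesis using that by (auto simp: \<F>_def s_def)
qed

lemma spectrum_Lambda_digits:
  assumes "uniformly_bounded A"
  shows "is_spectrum M (real_of_int ` Lambda_digits A)"
proof -
  interpret mu4_exponentials M "real_of_int ` Lambda_digits A" ..
  have "expo t \<in> closed_span" for t
    unfolding closed_span_def
  proof (safe intro!: expo_in_L2)
    fix \<epsilon> :: real assume "\<epsilon> > 0"
    obtain F where F: "finite F" "F \<subseteq> Lambda_digits A" "(\<Sum>l\<in>F. ft2 (t - of_int l)) > 1 - \<epsilon>"
      using sum_ft2_Lambda_arbitrarily_close[OF assms \<open>\<epsilon> > 0\<close>] .
    have proj: "(\<lambda>x. \<Sum>l\<in>real_of_int ` F. ft (t - l) * expo l x) \<in> lincomb"
      using F by (intro lincombI) auto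
    have "(\<integral>x. (cmod (expo t x - (\<Sum>l\<in>real_of_int ` F. ft (t - l) * expo l x)))\<^sup>2 \<partial>M) < \<epsilon>"
      unfolding norm_expo_diff_Lambda_projection[OF F(1,2)] using F(3) by simp
    then show "\<exists>g\<in>lincomb. (\<integral>x. (cmod (expo t x - g x))\<^sup>2 \<partial>M) < \<epsilon>"
      by (rule bexI[OF _ proj])
  qed
  then have dense: "closed_span = L2 M" by (rule closed_span_eq_L2_if_expo)
  have "\<exists>F c. finite F \<and> F \<subseteq> real_of_int ` Lambda_digits A \<and>
      L2_norm M (\<lambda>x. f x - (\<Sum>i\<in>F. c i * expo i x)) < \<epsilon>" if f: "f \<in> L2 M" and \<epsilon>: "\<epsilon> > 0" for f \<epsilon>
  proof -
    \<comment> \<open>The square compensates for the root in \<open>L2_norm\<close>.\<close>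
    obtain g where "g \<in> lincomb" and g: "(\<integral>x. (cmod (f x - g x))\<^sup>2 \<partial>M) < \<epsilon>\<^sup>2"
      using closed_spanE[of f "\<epsilon>\<^sup>2"] f \<epsilon> dense by auto
    then obtain F c where F: "finite F" "F \<subseteq> real_of_int ` Lambda_digits A"
      "g = (\<lambda>x. \<Sum>i\<in>F. c i * expo i x)" by (auto simp: lincomb_def)
    have "L2_norm M (\<lambda>x. f x - (\<Sum>i\<in>F. c i * expo i x)) < \<epsilon>"
      unfolding L2_norm_def using real_sqrt_less_mono[OF g] \<epsilon> by (simp add: F(3))
    with F show ?thesis by blast
  qed
  then show ?thesis
    using orthogonal_Lambda_digits[OF A]
    by (simp add: is_spectrum_def orthonormal_basis_def L2_norm_expo)
qed

end

end

theorem theorem4p4: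
  fixes \<mu>\<^sub>4 :: "real measure" and A :: "int list \<Rightarrow> int set"
  assumes "is_mu4 \<mu>\<^sub>4" and "digit_system A"
  shows "orthogonal_family \<mu>\<^sub>4 expo (real_of_int ` digit_sums A) \<and>
    (\<exists>L. spectral_labeling L \<and> digit_sums A \<subseteq> Lambda_labeling L \<and>
       (\<forall>L'. spectral_labeling L' \<and> digit_sums A \<subseteq> Lambda_labeling L' \<longrightarrow> same_labeling L' L) \<and>
       Lambda_labeling L = Lambda_digits A \<and>
       (uniformly_bounded A \<longrightarrow> is_spectrum \<mu>\<^sub>4 (real_of_int ` Lambda_labeling L)))"
proof -
  interpret mu4 \<mu>\<^sub>4 using assms(1) by (rule mu4.intro)
  note A = assms(2)
  have "orthogonal_family \<mu>\<^sub>4 expo (real_of_int ` digit_sums A)"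
    using orthogonal_Lambda_digits[OF A] digit_sums_subset[OF A]
    unfolding orthogonal_family_def by blast
  moreover have "digit_sums A \<subseteq> Lambda_labeling (digit_labeling A)"
    unfolding Lambda_digit_labeling[OF A] by (rule digit_sums_subset[OF A])
  ultimately show ?thesis
    using spectral_labeling_digit_labeling[OF A] digit_labeling_unique[OF A]
      Lambda_digit_labeling[OF A] spectrum_Lambda_digits[OF A]
    by (intro conjI exI[of _ "digit_labeling A"]) auto
qed

end
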